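(* Let $m\ge1$ and $g\in\mathrm{Gal}_k[m]$. Then for $1\le i\le r$, $$\tau_S^{[m]}(g)(X_i)=-\sum_{|J|=m+1}\mu(J)\,X_J,$$ where $J=(j_1\cdots j_{m+1})$ runs over multi-indices of length $m+1$ with entries in $\{1,\dots,r\}$, $X_J=X_{j_1}\otimes\cdots\otimes X_{j_{m+1}}$, and $$\mu(J)=\begin{cases}\mu(g;j_2\cdots j_{m+1}j_1)-\delta_{j_1,j_{m+1}}\,\mu(g;J)&(i=j_1),\\ \mu(g;j_2\cdots j_{m+1}j_1)\,\delta_{j_1,j_{m+1}}-\mu(g;J)&(i=j_{m+1}),\\ 0&\text{(otherwise)}.\end{cases}$$
   Context: Setup. Fix a prime $l$ and $r\ge2$. $\mathfrak F_r$ is the free pro-$l$ group on $x_1,\dots,x_r$, and $x_{r+1}:=(x_1\cdots x_r)^{-1}$. $S=(P_1,\dots,P_{r+1})$ is an ordered set of distinct $\overline{\mathbb Q}$-rational points of $\mathbb P^1$ ($\overline{\mathbb Q}\subset\mathbb C$) with $P_1=0,P_2=1,P_{r+1}=\infty$; $k=\mathbb Q(S\setminus\{\infty\})$ is the number field generated by the coordinates of $P_1,\dots,P_r$; $\mathrm{Gal}_k=\mathrm{Gal}(\overline{\mathbb Q}/k)$; $\chi_l:\mathrm{Gal}_k\to\mathbb Z_l^\times$ is the $l$-cyclotomic character. The maximal pro-$l$ quotient of the étale fundamental group of $\mathbb P^1_{\overline{\mathbb Q}}\setminus S$ is identified with $\mathfrak F_r$, $x_i$ being the class of a small loop around $P_i$;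 the monodromy action of $\mathrm{Gal}_k$ gives $\Phi_S:\mathrm{Gal}_k\to\mathrm{Out}(\mathfrak F_r)$. Let $P(\mathfrak F_r)$ be the group of $\varphi\in\mathrm{Aut}(\mathfrak F_r)$ for which there is $N(\varphi)\in\mathbb Z_l^\times$ such that $\varphi(x_i)$ is conjugate to $x_i^{N(\varphi)}$ for $1\le i\le r-1$, $\varphi(x_r)$ is conjugate to $x_r^{N(\varphi)}$ by an element of the subgroup generated by $[\mathfrak F_r,\mathfrak F_r]$ and $x_1,\dots,x_{r-2}$, and $\varphi(x_{r+1})=x_{r+1}^{N(\varphi)}$. Each $\Phi_S(g)$ has a unique representative $\mathrm{Ih}_S(g)\in P(\mathfrak F_r)$; $\mathrm{Ih}_S:\mathrm{Gal}_k\to P(\mathfrak F_r)$ is a continuous homomorphism (the Ihara representation) with $N(\mathrm{Ih}_S(g))=\chi_l(g)$. Longitudes and Milnor numbers. $H=\mathfrak F_r/[\mathfrak F_r,\mathfrak F_r]$ is the free $\mathbb Z_l$-module with basis $X_i=[x_i]$ ($1\le i\le r$). $y_i(g)\in\mathfrak F_r$ is the unique element with $\mathrm{Ih}_S(g)(x_i)=y_i(g)x_i^{\chi_l(g)}y_i(g)^{-1}$ and with the coefficient of $X_i$ in $[y_i(g)]\in H$ equal to $0$. $\widehat T(H)=\prod_{n\ge0}H^{\otimes n}=\mathbb Z_l\langle\langle X_1,\dots,X_r\rangle\rangle$, and $\Theta:\mathbb Z_l[[\mathfrak F_r]]\to\widehat T(H)$ is the topological algebra isomorphism $x_i\mapsto1+X_i$;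 $\mu(J;\alpha)$ is the coefficient of $X_J$ in $\Theta(\alpha)$. For $I=(i_1\cdots i_n)$ with $n\ge2$, $\mu(g;I):=\mu((i_1\cdots i_{n-1});y_{i_n}(g))$; $\mu(g;I):=0$ if $n=1$. Filtration and Johnson homomorphisms. $\mathfrak F_r(1)=\mathfrak F_r$, $\mathfrak F_r(n+1)=[\mathfrak F_r(n),\mathfrak F_r]$ (closed commutator subgroups). $\mathrm{Gal}_k[n]:=\{g\in\mathrm{Gal}_k:\mathrm{Ih}_S(g)(f)f^{-1}\in\mathfrak F_r(n+1)\ \text{for all } f\in\mathfrak F_r\}$. For $g\in\mathrm{Gal}_k$, $[\mathrm{Ih}_S(g)]$ denotes the automorphism of $H$ induced by $\mathrm{Ih}_S(g)$, and $\mathrm{Ih}_S(g)^*:=\Theta\circ\mathrm{Ih}_S(g)\circ\Theta^{-1}$ on $\widehat T(H)$ (with $\mathrm{Ih}_S(g)$ extended to $\mathbb Z_l[[\mathfrak F_r]]$). The pro-$l$ Johnson map is $\tau_S(g):=\mathrm{Ih}_S(g)^*\circ[\mathrm{Ih}_S(g)]^{-1}|_H-\mathrm{id}_H\in\mathrm{Hom}_{\mathbb Z_l}(H,\prod_{n\ge2}H^{\otimes n})$; $\tau_S^{(m)}(g)\in\mathrm{Hom}_{\mathbb Z_l}(H,H^{\otimes(m+1)})$ is its component in degree $m+1$, and $\tau_S^{[m]}:=\tau_S^{(m)}|_{\mathrm{Gal}_k[m]}$. *)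

theory Defs
  imports
    "HOL-Complex_Analysis.Complex_Analysis"
    "HOL-Algebra.Algebra"
    "Berlekamp_Zassenhaus.Finite_Field"
begin

section \<open>The l-adic integers\<close>

text \<open>The prime \<open>l\<close> is the cardinality of the type \<open>'l :: prime_card\<close>. An l-adic integer is
  stored as the sequence of its residues in \<open>{0..<l^n}\<close>.\<close>

typedef (overloaded) ('l :: prime_card) padic_int =
    "{a :: nat \<Rightarrow> int. \<forall>n. a n = a (Suc n) mod int CARD('l) ^ n}"
  morphisms padic_res Abs_padic_int
  by (rule exI[of _ "\<lambda>_. 0"]) simp

setup_lifting type_definition_padic_int

lemma padic_coherent:
  fixes f :: "nat \<Rightarrow> int"
  assumes "f n mod p ^ n = f (Suc n) mod p ^ n"
  shows "f n mod p ^ n = (f (Suc n) mod p ^ Suc n) mod p ^ n"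
  using assms by (simp add: mod_mod_cancel)

lemma padic_step:
  fixes f :: "nat \<Rightarrow> int"
  assumes "\<And>n. f n = f (Suc n) mod p ^ n"
  shows "f n mod p ^ n = f (Suc n) mod p ^ n"
proof -
  have "f n = f (Suc n) mod p ^ n" by (rule assms)
  then show ?thesis by (metis mod_mod_trivial)
qed

instantiation padic_int :: (prime_card) comm_ring_1
begin

lift_definition zero_padic_int :: "'a padic_int" is "\<lambda>_. 0" by simp

lift_definition one_padic_int :: "'a padic_int" is "\<lambda>n. 1 mod int CARD('a) ^ n"
  by (rule padic_coherent[of "\<lambda>_. 1"]) (rule refl)

lift_definition plus_padic_int :: "'a padic_int \<Rightarrow> 'a padic_int \<Rightarrow> 'a padic_int"
  is "\<lambda>a b n. (a n + b n) mod int CARD('a) ^ n"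
  by (rule padic_coherent, rule mod_add_cong) (erule padic_step)+

lift_definition minus_padic_int :: "'a padic_int \<Rightarrow> 'a padic_int \<Rightarrow> 'a padic_int"
  is "\<lambda>a b n. (a n - b n) mod int CARD('a) ^ n"
  by (rule padic_coherent, rule mod_diff_cong) (erule padic_step)+

lift_definition uminus_padic_int :: "'a padic_int \<Rightarrow> 'a padic_int"
  is "\<lambda>a n. (- a n) mod int CARD('a) ^ n"
  by (rule padic_coherent, rule mod_minus_cong) (erule padic_step)

lift_definition times_padic_int :: "'a padic_int \<Rightarrow> 'a padic_int \<Rightarrow> 'a padic_int"
  is "\<lambda>a b n. (a n * b n) mod int CARD('a) ^ n"
  by (rule padic_coherent, rule mod_mult_cong) (erule padic_step)+

instance
proof
  fix a b c :: "'a padic_int"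
  have res: "padic_res x n mod int CARD('a) ^ n = padic_res x n" for x :: "'a padic_int" and n
  proof -
    have "padic_res x n = padic_res x (Suc n) mod int CARD('a) ^ n"
      using padic_res[of x] by blast
    then show ?thesis by (metis mod_mod_trivial)
  qed
  note defs = padic_res_inject[symmetric] fun_eq_iff zero_padic_int.rep_eq one_padic_int.rep_eq
    plus_padic_int.rep_eq minus_padic_int.rep_eq uminus_padic_int.rep_eq times_padic_int.rep_eq
  show "a * b * c = a * (b * c)"
    by (simp add: defs mod_mult_left_eq mod_mult_right_eq mult.assoc)
  show "a * b = b * a"
    by (simp add: defs mult.commute)
  show "1 * a = a"
    by (simp add: defs mod_mult_left_eq res)
  show "a + b + c = a + (b + c)"
    by (simp add: defs mod_add_left_eq mod_add_right_eq add.assoc)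
  show "a + b = b + a"
    by (simp add: defs add.commute)
  show "0 + a = a"
    by (simp add: defs res)
  show "- a + a = 0"
    by (simp add: defs mod_add_left_eq)
  show "a - b = a + - b"
    by (simp add: defs mod_add_right_eq)
  show "(a + b) * c = a * c + b * c"
    by (simp add: defs mod_mult_left_eq mod_add_eq distrib_right)
  have "int CARD('a) > 1"
    using prime_card_int[where 'a = 'a] by (rule prime_gt_1_int)
  then show "(0 :: 'a padic_int) \<noteq> 1"
    by (metis mod_pos_pos_trivial one_padic_int.rep_eq power_one_right zero_le_one
        zero_neq_one zero_padic_int.rep_eq)
qed

end

definition padic_topology :: "('l :: prime_card) padic_int topology" where
  "padic_topology =
     pullback_topology UNIV padic_res (product_topology (\<lambda>_. discrete_topology UNIV) UNIV)"


section \<open>Non-commutative formal power series\<close>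

text \<open>Words are lists of letters. Only words over the letters \<open>1, \<dots>, r\<close> matter; the space
  \<open>nc_space r\<close> of the series supported on them is the completed tensor algebra of \<open>H\<close>.\<close>

typedef 'a ncps = "UNIV :: (nat list \<Rightarrow> 'a) set"
  morphisms nc_coeff Abs_ncps ..

setup_lifting type_definition_ncps

instantiation ncps :: (comm_ring_1) ring_1
begin

lift_definition zero_ncps :: "'a ncps" is "\<lambda>_. 0" .
lift_definition one_ncps :: "'a ncps" is "\<lambda>w. if w = [] then 1 else 0" .
lift_definition plus_ncps :: "'a ncps \<Rightarrow> 'a ncps \<Rightarrow> 'a ncps" is "\<lambda>f g w. f w + g w" .
lift_definition minus_ncps :: "'a ncps \<Rightarrow> 'a ncps \<Rightarrow> 'a ncps" is "\<lambda>f g w. f w - g w" .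
lift_definition uminus_ncps :: "'a ncps \<Rightarrow> 'a ncps" is "\<lambda>f w. - f w" .
lift_definition times_ncps :: "'a ncps \<Rightarrow> 'a ncps \<Rightarrow> 'a ncps"
  is "\<lambda>f g w. \<Sum>i = 0..length w. f (take i w) * g (drop i w)" .

instance
proof
  fix a b c :: "'a ncps"
  show "a * b * c = a * (b * c)"
  proof (transfer, rule ext)
    fix f g h :: "nat list \<Rightarrow> 'a" and w :: "nat list"
    let ?n = "length w"
    let ?F = "\<lambda>i j (_::nat). f (take i w) * g (take j (drop i w)) * h (drop (i + j) w)"
    have "(\<Sum>j = 0..?n. (\<Sum>i = 0..length (take j w).
             f (take i (take j w)) * g (drop i (take j w))) * h (drop j w))
        = (\<Sum>j = 0..?n. \<Sum>i = 0..j. ?F i (j - i) (?n - j))"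
      by (intro sum.cong refl) (auto simp: sum_distrib_right min_def drop_take)
    also have "\<dots> = (\<Sum>j = 0..?n. \<Sum>i = 0..?n - j. ?F j i (?n - j - i))"
      by (rule fps_mult_assoc_lemma)
    also have "\<dots> = (\<Sum>i = 0..?n. f (take i w) * (\<Sum>j = 0..length (drop i w).
             g (take j (drop i w)) * h (drop j (drop i w))))"
      by (simp add: sum_distrib_left mult.assoc add.commute)
    finally show "(\<Sum>j = 0..?n. (\<Sum>i = 0..length (take j w).
             f (take i (take j w)) * g (drop i (take j w))) * h (drop j w))
        = (\<Sum>i = 0..?n. f (take i w) * (\<Sum>j = 0..length (drop i w).
             g (take j (drop i w)) * h (drop j (drop i w))))" .
  qed
  show "1 * a = a"
  proof (transfer, rule ext)
    fix f :: "nat list \<Rightarrow> 'a" and w :: "nat list"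
    have "(\<Sum>i = 0..length w. (if take i w = [] then 1 else 0) * f (drop i w))
        = (\<Sum>i \<in> {0..length w}. if i = 0 then f w else 0)"
      by (intro sum.cong refl) auto
    then show "(\<Sum>i = 0..length w. (if take i w = [] then 1 else 0) * f (drop i w)) = f w"
      by simp
  qed
  show "a * 1 = a"
  proof (transfer, rule ext)
    fix f :: "nat list \<Rightarrow> 'a" and w :: "nat list"
    have "(\<Sum>i = 0..length w. f (take i w) * (if drop i w = [] then 1 else 0))
        = (\<Sum>i \<in> {0..length w}. if i = length w then f w else 0)"
      by (intro sum.cong refl) auto
    then show "(\<Sum>i = 0..length w. f (take i w) * (if drop i w = [] then 1 else 0)) = f w"
      by simp
  qed
  show "a + b + c = a + (b + c)" by transfer (simp add: add.assoc)
  show "a + b = b + a" by transfer (simp add: add.commute)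
  show "0 + a = a" by transfer simp
  show "- a + a = 0" by transfer simp
  show "a - b = a + - b" by transfer simp
  show "(a + b) * c = a * c + b * c"
    by transfer (simp add: distrib_right sum.distrib)
  show "a * (b + c) = a * b + a * c"
    by transfer (simp add: distrib_left sum.distrib)
  show "(0 :: 'a ncps) \<noteq> 1"
    by transfer (metis zero_neq_one)
qed

end

lift_definition nc_smult :: "'a :: comm_ring_1 \<Rightarrow> 'a ncps \<Rightarrow> 'a ncps" is "\<lambda>c f w. c * f w" .

definition nc_mono :: "nat list \<Rightarrow> ('a :: comm_ring_1) ncps" where
  "nc_mono J = Abs_ncps (\<lambda>w. if w = J then 1 else 0)"

definition nc_X :: "nat \<Rightarrow> ('a :: comm_ring_1) ncps" where
  "nc_X i = nc_mono [i]"

definition nc_degree_part :: "nat \<Rightarrow> ('a :: comm_ring_1) ncps \<Rightarrow> 'a ncps" where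
  "nc_degree_part n f = Abs_ncps (\<lambda>w. if length w = n then nc_coeff f w else 0)"

definition words :: "nat \<Rightarrow> nat \<Rightarrow> nat list set" where
  "words r n = {w. set w \<subseteq> {1..r} \<and> length w = n}"

definition nc_space :: "nat \<Rightarrow> ('a :: comm_ring_1) ncps set" where
  "nc_space r = {f. \<forall>w. nc_coeff f w \<noteq> 0 \<longrightarrow> set w \<subseteq> {1..r}}"

text \<open>The summand \<open>H\<close> of degree one, free on \<open>X\<^sub>1, \<dots>, X\<^sub>r\<close>.\<close>

definition nc_H :: "nat \<Rightarrow> ('a :: comm_ring_1) ncps set" where
  "nc_H r = {f. \<forall>w. nc_coeff f w \<noteq> 0 \<longrightarrow> w \<in> words r 1}"

definition nc_topology :: "nat \<Rightarrow> ('l :: prime_card) padic_int ncps topology" where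
  "nc_topology r =
     pullback_topology (nc_space r) nc_coeff (product_topology (\<lambda>_. padic_topology) UNIV)"


section \<open>Pro-l groups\<close>

definition open_normals :: "('a, 'b) monoid_scheme \<Rightarrow> 'a topology \<Rightarrow> 'a set set" where
  "open_normals G T = {N. N \<lhd> G \<and> openin T N}"

definition pro_group :: "nat \<Rightarrow> ('a, 'b) monoid_scheme \<Rightarrow> 'a topology \<Rightarrow> bool" where
  "pro_group l G T \<longleftrightarrow>
     group G \<and> topspace T = carrier G \<and> compact_space T \<and> Hausdorff_space T \<and>
     continuous_map (prod_topology T T) T (\<lambda>(a, b). a \<otimes>\<^bsub>G\<^esub> b) \<and>
     continuous_map T T (\<lambda>a. inv\<^bsub>G\<^esub> a) \<and>
     (\<forall>U. openin T U \<and> \<one>\<^bsub>G\<^esub> \<in> U \<longrightarrow>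
        (\<exists>N \<in> open_normals G T. N \<subseteq> U \<and> (\<exists>n. card (rcosets\<^bsub>G\<^esub> N) = l ^ n)))"

text \<open>The universal property only has to be tested on finite l-groups, and every finite group
  has a copy on a set of natural numbers.\<close>

definition free_pro_group ::
    "nat \<Rightarrow> nat \<Rightarrow> ('a, 'b) monoid_scheme \<Rightarrow> 'a topology \<Rightarrow> (nat \<Rightarrow> 'a) \<Rightarrow> bool" where
  "free_pro_group l r G T x \<longleftrightarrow>
     pro_group l G T \<and> (\<forall>i\<in>{1..r}. x i \<in> carrier G) \<and>
     (\<forall>Q :: nat monoid. \<forall>a. group Q \<and> (\<exists>n. order Q = l ^ n) \<and> (\<forall>i\<in>{1..r}. a i \<in> carrier Q) \<longrightarrow>
        (\<exists>!h. h \<in> hom G Q \<and> h \<in> extensional (carrier G) \<and>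
              continuous_map T (discrete_topology (carrier Q)) h \<and>
              (\<forall>i\<in>{1..r}. h (x i) = a i)))"

definition closed_subgroup_generated ::
    "('a, 'b) monoid_scheme \<Rightarrow> 'a topology \<Rightarrow> 'a set \<Rightarrow> 'a set" where
  "closed_subgroup_generated G T A = Abstract_Topology.closure_of T (generate G A)"

text \<open>Lower central series, numbered from 1 (the value at 0 is a dummy).\<close>

fun pro_lcs :: "('a, 'b) monoid_scheme \<Rightarrow> 'a topology \<Rightarrow> nat \<Rightarrow> 'a set" where
  "pro_lcs G T 0 = carrier G"
| "pro_lcs G T (Suc 0) = carrier G"
| "pro_lcs G T (Suc (Suc n)) = closed_subgroup_generated G T
     {a \<otimes>\<^bsub>G\<^esub> b \<otimes>\<^bsub>G\<^esub> inv\<^bsub>G\<^esub> a \<otimes>\<^bsub>G\<^esub> inv\<^bsub>G\<^esub> b | a b. a \<in> pro_lcs G T (Suc n) \<and> b \<in> carrier G}"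

definition pro_pow ::
    "('a, 'b) monoid_scheme \<Rightarrow> 'a topology \<Rightarrow> 'a \<Rightarrow> ('l :: prime_card) padic_int \<Rightarrow> 'a" where
  "pro_pow G T x a = (THE z. limitin T (\<lambda>k. x [^]\<^bsub>G\<^esub> nat (padic_res a k)) z sequentially)"

definition ordered_prod :: "('a, 'b) monoid_scheme \<Rightarrow> nat \<Rightarrow> (nat \<Rightarrow> 'a) \<Rightarrow> 'a" where
  "ordered_prod G r f = foldr (\<lambda>i a. f i \<otimes>\<^bsub>G\<^esub> a) [1..<Suc r] \<one>\<^bsub>G\<^esub>"

definition gen_infinity :: "('a, 'b) monoid_scheme \<Rightarrow> nat \<Rightarrow> (nat \<Rightarrow> 'a) \<Rightarrow> 'a" where
  "gen_infinity G r x = inv\<^bsub>G\<^esub> (ordered_prod G r x)"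

definition top_auto :: "('a, 'b) monoid_scheme \<Rightarrow> 'a topology \<Rightarrow> ('a \<Rightarrow> 'a) set" where
  "top_auto G T = {\<phi> \<in> auto G. homeomorphic_map T T \<phi>}"

text \<open>The \<open>\<phi> \<in> P(F)\<close> whose multiplier \<open>N(\<phi>)\<close> is the unit \<open>N\<close>.\<close>

definition ihara_P :: "('a, 'b) monoid_scheme \<Rightarrow> 'a topology \<Rightarrow> nat \<Rightarrow> (nat \<Rightarrow> 'a) \<Rightarrow>
    ('l :: prime_card) padic_int \<Rightarrow> ('a \<Rightarrow> 'a) set" where
  "ihara_P G T r x N = {\<phi> \<in> top_auto G T.
     N dvd 1 \<and>
     (\<forall>i\<in>{1..r-1}. \<exists>y\<in>carrier G. \<phi> (x i) = y \<otimes>\<^bsub>G\<^esub> pro_pow G T (x i) N \<otimes>\<^bsub>G\<^esub> inv\<^bsub>G\<^esub> y) \<and>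
     (\<exists>y\<in>closed_subgroup_generated G T (pro_lcs G T 2 \<union> x ` {1..r-2}).
        \<phi> (x r) = y \<otimes>\<^bsub>G\<^esub> pro_pow G T (x r) N \<otimes>\<^bsub>G\<^esub> inv\<^bsub>G\<^esub> y) \<and>
     \<phi> (gen_infinity G r x) = pro_pow G T (gen_infinity G r x) N}"


section \<open>Completed group algebras\<close>

text \<open>An element of the inverse limit of the group algebras of the finite quotients \<open>G/N\<close>,
  \<open>N\<close> open normal, is a function on all cosets of such \<open>N\<close>; a coset \<open>C\<close> determines its \<open>N\<close>.
  The function is 0 on all other sets. Compatibility says that the value at a coset is the sum of
  the values at the smaller cosets which partition it.\<close>

definition open_cosets :: "('a, 'b) monoid_scheme \<Rightarrow> 'a topology \<Rightarrow> 'a set set" where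
  "open_cosets G T = (\<Union>N\<in>open_normals G T. rcosets\<^bsub>G\<^esub> N)"

definition coset_normal :: "('a, 'b) monoid_scheme \<Rightarrow> 'a set \<Rightarrow> 'a set" where
  "coset_normal G C = {u \<otimes>\<^bsub>G\<^esub> inv\<^bsub>G\<^esub> v | u v. u \<in> C \<and> v \<in> C}"

definition group_algebra ::
    "('a, 'b) monoid_scheme \<Rightarrow> 'a topology \<Rightarrow> ('a set \<Rightarrow> ('l :: prime_card) padic_int) set" where
  "group_algebra G T = {a.
     (\<forall>C. C \<notin> open_cosets G T \<longrightarrow> a C = 0) \<and>
     (\<forall>N\<in>open_normals G T. \<forall>N'\<in>open_normals G T. N' \<subseteq> N \<longrightarrow>
        (\<forall>C\<in>rcosets\<^bsub>G\<^esub> N. a C = (\<Sum>C' \<in> {C' \<in> rcosets\<^bsub>G\<^esub> N'. C' \<subseteq> C}. a C')))}"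

definition group_algebra_topology ::
    "('a, 'b) monoid_scheme \<Rightarrow> 'a topology \<Rightarrow> ('a set \<Rightarrow> ('l :: prime_card) padic_int) topology" where
  "group_algebra_topology G T =
     subtopology (product_topology (\<lambda>_. padic_topology) UNIV) (group_algebra G T)"

definition group_algebra_mult :: "('a, 'b) monoid_scheme \<Rightarrow> 'a topology \<Rightarrow>
    ('a set \<Rightarrow> ('l :: prime_card) padic_int) \<Rightarrow> ('a set \<Rightarrow> 'l padic_int) \<Rightarrow> ('a set \<Rightarrow> 'l padic_int)" where
  "group_algebra_mult G T a b = (\<lambda>C. if C \<in> open_cosets G T
     then (\<Sum>(A, B) \<in> {(A, B). A \<in> rcosets\<^bsub>G\<^esub> (coset_normal G C) \<and>
                               B \<in> rcosets\<^bsub>G\<^esub> (coset_normal G C) \<and> A <#>\<^bsub>G\<^esub> B = C}. a A * b B)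
     else 0)"

definition group_element ::
    "('a, 'b) monoid_scheme \<Rightarrow> 'a topology \<Rightarrow> 'a \<Rightarrow> ('a set \<Rightarrow> ('l :: prime_card) padic_int)" where
  "group_element G T f = (\<lambda>C. if C \<in> open_cosets G T \<and> f \<in> C then 1 else 0)"

text \<open>The continuous linear extension of an automorphism \<open>\<phi>\<close>.\<close>

definition group_algebra_map :: "('a, 'b) monoid_scheme \<Rightarrow> 'a topology \<Rightarrow> ('a \<Rightarrow> 'a) \<Rightarrow>
    ('a set \<Rightarrow> ('l :: prime_card) padic_int) \<Rightarrow> ('a set \<Rightarrow> 'l padic_int)" where
  "group_algebra_map G T \<phi> a =
     (\<lambda>C. if C \<in> open_cosets G T then a {f \<in> carrier G. \<phi> f \<in> C} else 0)"

definition magnus_iso :: "('a, 'b) monoid_scheme \<Rightarrow> 'a topology \<Rightarrow> nat \<Rightarrow> (nat \<Rightarrow> 'a) \<Rightarrow>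
    (('a set \<Rightarrow> ('l :: prime_card) padic_int) \<Rightarrow> 'l padic_int ncps) \<Rightarrow> bool" where
  "magnus_iso G T r x \<Theta> \<longleftrightarrow>
     homeomorphic_map (group_algebra_topology G T) (nc_topology r) \<Theta> \<and>
     (\<forall>a\<in>group_algebra G T. \<forall>b\<in>group_algebra G T.
        \<Theta> (\<lambda>C. a C + b C) = \<Theta> a + \<Theta> b \<and>
        \<Theta> (group_algebra_mult G T a b) = \<Theta> a * \<Theta> b) \<and>
     (\<forall>c. \<forall>a\<in>group_algebra G T. \<Theta> (\<lambda>C. c * a C) = nc_smult c (\<Theta> a)) \<and>
     \<Theta> (group_element G T \<one>\<^bsub>G\<^esub>) = 1 \<and>
     (\<forall>i\<in>{1..r}. \<Theta> (group_element G T (x i)) = 1 + nc_X i)"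


section \<open>Fields and Galois groups\<close>

definition subfield_of :: "('k :: field) set \<Rightarrow> bool" where
  "subfield_of K \<longleftrightarrow> 0 \<in> K \<and> 1 \<in> K \<and>
     (\<forall>a\<in>K. \<forall>b\<in>K. a + b \<in> K \<and> a - b \<in> K \<and> a * b \<in> K) \<and> (\<forall>a\<in>K. inverse a \<in> K)"

definition field_auts :: "('k :: field) set \<Rightarrow> 'k set \<Rightarrow> ('k \<Rightarrow> 'k) set" where
  "field_auts L K = {\<sigma> \<in> Bij L.
     (\<forall>a\<in>L. \<forall>b\<in>L. \<sigma> (a + b) = \<sigma> a + \<sigma> b \<and> \<sigma> (a * b) = \<sigma> a * \<sigma> b) \<and> (\<forall>a\<in>K. \<sigma> a = a)}"

text \<open>Artin's criterion: \<open>L/K\<close> is finite Galois of degree \<open>card (field_auts L K)\<close>.\<close>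

definition finite_galois :: "('k :: field) set \<Rightarrow> 'k set \<Rightarrow> bool" where
  "finite_galois L K \<longleftrightarrow> subfield_of L \<and> subfield_of K \<and> K \<subseteq> L \<and> finite (field_auts L K) \<and>
     {a \<in> L. \<forall>\<sigma>\<in>field_auts L K. \<sigma> a = a} = K"

definition galois_group :: "('k :: field) set \<Rightarrow> 'k set \<Rightarrow> ('k \<Rightarrow> 'k) monoid" where
  "galois_group L K = (BijGroup L) \<lparr>carrier := field_auts L K\<rparr>"

definition krull_topology :: "('k :: field) set \<Rightarrow> 'k set \<Rightarrow> ('k \<Rightarrow> 'k) topology" where
  "krull_topology L K =
     subtopology (product_topology (\<lambda>_. discrete_topology L) L) (field_auts L K)"

definition Qbar :: "complex set" where
  "Qbar = {z. algebraic z}"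

definition point_field :: "nat \<Rightarrow> (nat \<Rightarrow> complex) \<Rightarrow> complex set" where
  "point_field r P = subfield_of hull (P ` {1..r})"

definition Gal_k :: "nat \<Rightarrow> (nat \<Rightarrow> complex) \<Rightarrow> (complex \<Rightarrow> complex) set" where
  "Gal_k r P = field_auts Qbar (point_field r P)"

definition cyclotomic_char :: "(complex \<Rightarrow> complex) \<Rightarrow> ('l :: prime_card) padic_int" where
  "cyclotomic_char g = (THE a. \<forall>n \<zeta>. \<zeta> ^ (CARD('l) ^ n) = 1 \<longrightarrow> g \<zeta> = \<zeta> ^ nat (padic_res a n))"


section \<open>The pro-l fundamental group of the punctured line and its Galois action\<close>

text \<open>All algebraic functions unramified at a base point \<open>b\<close> are realised as Laurent germs at \<open>b\<close>.
  The maximal pro-l quotient of the etale fundamental group of the line over \<open>Qbar\<close> minus \<open>S\<close>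
  is the Galois group over \<open>Qbar(t)\<close> of the maximal pro-l extension of \<open>Qbar(t)\<close>
  unramified outside \<open>S\<close>; the group of \<open>k\<close> acts on it through the extension
  \<open>1 \<rightarrow> Gal(M/Qbar(t)) \<rightarrow> Gal(M/k(t)) \<rightarrow> Gal(Qbar/k) \<rightarrow> 1\<close>.\<close>

definition t_at :: "complex \<Rightarrow> complex fls" where
  "t_at b = fls_const b + fls_X"

definition rat_funs :: "complex \<Rightarrow> complex fls set" where
  "rat_funs b = subfield_of hull (insert (t_at b) (fls_const ` Qbar))"

text \<open>For a Galois extension \<open>L\<close> of \<open>Qbar(t)\<close>: no ramification over the point \<open>c\<close> means that
  \<open>L\<close> embeds over \<open>Qbar(t)\<close> into the field of Laurent series in \<open>t - c\<close>.\<close>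

definition unramified_over :: "complex \<Rightarrow> complex fls set \<Rightarrow> complex \<Rightarrow> bool" where
  "unramified_over b L c \<longleftrightarrow> (\<exists>e :: complex fls \<Rightarrow> complex fls.
     (\<forall>f\<in>L. \<forall>h\<in>L. e (f + h) = e f + e h \<and> e (f * h) = e f * e h) \<and>
     (\<forall>a\<in>Qbar. e (fls_const a) = fls_const a) \<and> e (t_at b) = t_at c)"

definition max_pro_ext :: "nat \<Rightarrow> complex set \<Rightarrow> complex \<Rightarrow> complex fls set" where
  "max_pro_ext l S b = \<Union>{L. finite_galois L (rat_funs b) \<and>
     (\<exists>n. card (field_auts L (rat_funs b)) = l ^ n) \<and>
     (\<forall>c \<in> Qbar - S. unramified_over b L c)}"

definition continued_along :: "(real \<Rightarrow> complex) \<Rightarrow> complex fls \<Rightarrow> complex fls \<Rightarrow> bool" where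
  "continued_along \<gamma> f h \<longleftrightarrow> (\<exists>germ :: real \<Rightarrow> complex fls.
     germ 0 = f \<and> germ 1 = h \<and>
     (\<forall>s\<in>{0..1}. \<exists>\<epsilon>>0. \<exists>u :: complex \<Rightarrow> complex. \<forall>s'\<in>{0..1}. \<bar>s' - s\<bar> < \<epsilon> \<longrightarrow>
        (\<lambda>w. u (\<gamma> s' + w)) has_laurent_expansion germ s'))"

definition small_loop :: "complex set \<Rightarrow> complex \<Rightarrow> complex \<Rightarrow> (real \<Rightarrow> complex) \<Rightarrow> bool" where
  "small_loop S b c \<gamma> \<longleftrightarrow> (\<exists>\<beta> \<rho>. \<rho> > 0 \<and> cball c \<rho> \<inter> S = {c} \<and>
     path \<beta> \<and> path_image \<beta> \<inter> S = {} \<and> pathstart \<beta> = b \<and> pathfinish \<beta> = c + of_real \<rho> \<and>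
     \<gamma> = \<beta> +++ circlepath c \<rho> +++ reversepath \<beta>)"

text \<open>Counterclockwise around infinity is clockwise in the finite plane.\<close>

definition small_loop_infinity :: "complex set \<Rightarrow> complex \<Rightarrow> (real \<Rightarrow> complex) \<Rightarrow> bool" where
  "small_loop_infinity S b \<gamma> \<longleftrightarrow> (\<exists>\<beta> \<rho>. \<rho> > 0 \<and> S \<subseteq> ball 0 \<rho> \<and>
     path \<beta> \<and> path_image \<beta> \<inter> S = {} \<and> pathstart \<beta> = b \<and> pathfinish \<beta> = of_real \<rho> \<and>
     \<gamma> = \<beta> +++ reversepath (circlepath 0 \<rho>) +++ reversepath \<beta>)"

definition lifts :: "complex fls set \<Rightarrow> complex \<Rightarrow> (complex \<Rightarrow> complex) \<Rightarrow>
    (complex fls \<Rightarrow> complex fls) set" where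
  "lifts M b g = {s \<in> field_auts M {t_at b}. \<forall>a\<in>Qbar. s (fls_const a) = fls_const (g a)}"


section \<open>The Ihara representation, Milnor numbers and Johnson maps\<close>

record ('a, 'l) ihara_data =
  rk :: nat                                          \<comment> \<open>\<open>r\<close>\<close>
  pts :: "nat \<Rightarrow> complex"                             \<comment> \<open>\<open>P\<^sub>1, \<dots>, P\<^sub>r\<close>; the last point is infinity\<close>
  base :: complex                                    \<comment> \<open>base point of the loops\<close>
  Fr :: "'a monoid"                                  \<comment> \<open>the free pro-l group\<close>
  Frtop :: "'a topology"
  gen :: "nat \<Rightarrow> 'a"                                  \<comment> \<open>\<open>x\<^sub>1, \<dots>, x\<^sub>r\<close>\<close>
  ident :: "'a \<Rightarrow> complex fls \<Rightarrow> complex fls"          \<comment> \<open>identification with the pro-l fundamental group\<close>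
  Magnus :: "('a set \<Rightarrow> 'l padic_int) \<Rightarrow> 'l padic_int ncps"   \<comment> \<open>\<open>\<Theta>\<close>\<close>
  Ih :: "(complex \<Rightarrow> complex) \<Rightarrow> 'a \<Rightarrow> 'a"            \<comment> \<open>the Ihara representation\<close>

context
  fixes D :: "('a, 'l :: prime_card) ihara_data"
begin

definition "finite_pts = pts D ` {1..rk D}"

definition "cover_field = max_pro_ext CARD('l) finite_pts (base D)"

definition "Gal = Gal_k (rk D) (pts D)"

text \<open>\<open>x\<^sub>i\<close> is the class of a small loop around \<open>P\<^sub>i\<close>, for \<open>1 \<le> i \<le> r + 1\<close>. A loop acts on germs by
  analytic continuation.\<close>

definition identification :: bool where
  "identification \<longleftrightarrow>
     ident D \<in> iso (Fr D) (galois_group cover_field (rat_funs (base D))) \<and>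
     homeomorphic_map (Frtop D) (krull_topology cover_field (rat_funs (base D))) (ident D) \<and>
     (\<forall>i\<in>{1..rk D}. \<exists>\<gamma>. small_loop finite_pts (base D) (pts D i) \<gamma> \<and>
        (\<forall>f\<in>cover_field. continued_along \<gamma> f (ident D (gen D i) f))) \<and>
     (\<exists>\<gamma>. small_loop_infinity finite_pts (base D) \<gamma> \<and>
        (\<forall>f\<in>cover_field. continued_along \<gamma> f (ident D (gen_infinity (Fr D) (rk D) (gen D)) f)))"

text \<open>\<open>\<Phi>\<^sub>S(g)\<close> as a coset of the inner automorphisms: the automorphisms which correspond to
  \<open>\<sigma> \<mapsto> s \<circ> \<sigma> \<circ> s\<^sup>-\<^sup>1\<close> for a lift \<open>s\<close> of \<open>g\<close>.\<close>

definition outer_action :: "(complex \<Rightarrow> complex) \<Rightarrow> ('a \<Rightarrow> 'a) set" where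
  "outer_action g = {\<psi> \<in> top_auto (Fr D) (Frtop D). \<exists>s\<in>lifts cover_field (base D) g.
     \<forall>f\<in>carrier (Fr D). \<forall>h\<in>cover_field. ident D (\<psi> f) (s h) = s (ident D f h)}"

text \<open>The last clause is the defining property of the Ihara representation: \<open>Ih(g)\<close> is the
  representative of \<open>\<Phi>\<^sub>S(g)\<close> in \<open>P(F)\<close>, and its multiplier is the cyclotomic character.\<close>

definition ihara_setting :: bool where
  "ihara_setting \<longleftrightarrow>
     rk D \<ge> 2 \<and>
     inj_on (pts D) {1..rk D} \<and> (\<forall>i\<in>{1..rk D}. pts D i \<in> Qbar) \<and> pts D 1 = 0 \<and> pts D 2 = 1 \<and>
     base D \<notin> finite_pts \<and>
     free_pro_group CARD('l) (rk D) (Fr D) (Frtop D) (gen D) \<and>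
     identification \<and>
     magnus_iso (Fr D) (Frtop D) (rk D) (gen D) (Magnus D) \<and>
     (\<forall>g\<in>Gal. Ih D g \<in> outer_action g \<and>
        Ih D g \<in> ihara_P (Fr D) (Frtop D) (rk D) (gen D) (cyclotomic_char g :: 'l padic_int))"

text \<open>Coordinates of the class of \<open>f\<close> in \<open>H = F/[F,F]\<close> with respect to \<open>X\<^sub>1, \<dots>, X\<^sub>r\<close>.\<close>

definition ab_coord :: "'a \<Rightarrow> nat \<Rightarrow> 'l padic_int" where
  "ab_coord f = (THE c. (\<forall>i. i \<notin> {1..rk D} \<longrightarrow> c i = 0) \<and>
     f \<in> ordered_prod (Fr D) (rk D) (\<lambda>i. pro_pow (Fr D) (Frtop D) (gen D i) (c i))
           <#\<^bsub>Fr D\<^esub> pro_lcs (Fr D) (Frtop D) 2)"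

definition ab_class :: "'a \<Rightarrow> 'l padic_int ncps" where
  "ab_class f = (\<Sum>i\<in>{1..rk D}. nc_smult (ab_coord f i) (nc_X i))"

definition ab_map :: "('a \<Rightarrow> 'a) \<Rightarrow> 'l padic_int ncps \<Rightarrow> 'l padic_int ncps" where
  "ab_map \<phi> h = (THE h'. \<exists>f\<in>carrier (Fr D). ab_class f = h \<and> ab_class (\<phi> f) = h')"

definition longitude :: "(complex \<Rightarrow> complex) \<Rightarrow> nat \<Rightarrow> 'a" where
  "longitude g i = (THE y. y \<in> carrier (Fr D) \<and>
     Ih D g (gen D i) = y \<otimes>\<^bsub>Fr D\<^esub>
       pro_pow (Fr D) (Frtop D) (gen D i) (cyclotomic_char g :: 'l padic_int) \<otimes>\<^bsub>Fr D\<^esub> inv\<^bsub>Fr D\<^esub> y \<and>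
     ab_coord y i = 0)"

definition magnus_coeff :: "nat list \<Rightarrow> ('a set \<Rightarrow> 'l padic_int) \<Rightarrow> 'l padic_int" where
  "magnus_coeff J \<alpha> = nc_coeff (Magnus D \<alpha>) J"

definition milnor :: "(complex \<Rightarrow> complex) \<Rightarrow> nat list \<Rightarrow> 'l padic_int" where
  "milnor g I = (if length I \<ge> 2
     then magnus_coeff (butlast I) (group_element (Fr D) (Frtop D) (longitude g (last I))) else 0)"

definition Gal_filtration :: "nat \<Rightarrow> (complex \<Rightarrow> complex) set" where
  "Gal_filtration m = {g \<in> Gal. \<forall>f\<in>carrier (Fr D).
     Ih D g f \<otimes>\<^bsub>Fr D\<^esub> inv\<^bsub>Fr D\<^esub> f \<in> pro_lcs (Fr D) (Frtop D) (m + 1)}"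

definition Ih_star :: "(complex \<Rightarrow> complex) \<Rightarrow> 'l padic_int ncps \<Rightarrow> 'l padic_int ncps" where
  "Ih_star g a = Magnus D (group_algebra_map (Fr D) (Frtop D) (Ih D g)
     (inv_into (group_algebra (Fr D) (Frtop D)) (Magnus D) a))"

definition johnson :: "(complex \<Rightarrow> complex) \<Rightarrow> 'l padic_int ncps \<Rightarrow> 'l padic_int ncps" where
  "johnson g = (\<lambda>h\<in>nc_H (rk D). Ih_star g (inv_into (nc_H (rk D)) (ab_map (Ih D g)) h) - h)"

definition johnson_part ::
    "nat \<Rightarrow> (complex \<Rightarrow> complex) \<Rightarrow> 'l padic_int ncps \<Rightarrow> 'l padic_int ncps" where
  "johnson_part m g = (\<lambda>h\<in>nc_H (rk D). nc_degree_part (m + 1) (johnson g h))"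

definition johnson_hom ::
    "nat \<Rightarrow> (complex \<Rightarrow> complex) \<Rightarrow> 'l padic_int ncps \<Rightarrow> 'l padic_int ncps" where
  "johnson_hom m = restrict (johnson_part m) (Gal_filtration m)"

text \<open>The coefficient \<open>\<mu>(J)\<close>, for \<open>J = (j\<^sub>1 \<dots> j\<^sub>n)\<close> nonempty; \<open>rotate1 J = (j\<^sub>2 \<dots> j\<^sub>n j\<^sub>1)\<close>.
  The first two cases overlap when \<open>i = j\<^sub>1 = j\<^sub>n\<close> and agree there.\<close>

definition mu_coeff :: "(complex \<Rightarrow> complex) \<Rightarrow> nat \<Rightarrow> nat list \<Rightarrow> 'l padic_int" where
  "mu_coeff g i J =
     (if i = hd J then milnor g (rotate1 J) - of_bool (hd J = last J) * milnor g J
      else if i = last J then milnor g (rotate1 J) * of_bool (hd J = last J) - milnor g J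
      else 0)"

end

end

theory Submission
  imports Defs
begin

text \<open>Let \<open>\<theta>(f)\<close> be the Magnus expansion of \<open>f\<close>, so that \<open>\<theta>(x\<^sub>i) = 1 + X\<^sub>i\<close>, let \<open>\<phi>\<close> be the automorphism
  given by \<open>g\<close>, and let \<open>y = y\<^sub>i(g)\<close> be the longitude. Since \<open>m \<ge> 1\<close>, \<open>\<phi>\<close> acts trivially on the
  abelianization \<open>H\<close>. This has two consequences: the Johnson map sends \<open>X\<^sub>i\<close> to
  \<open>\<theta>(\<phi>(x\<^sub>i)) - \<theta>(x\<^sub>i)\<close>, and the cyclotomic multiplier of \<open>g\<close> is 1, so that
  \<open>\<phi>(x\<^sub>i) = y x\<^sub>i y\<^sup>-\<^sup>1\<close>. Hence
  \<open>(\<theta>(\<phi>(x\<^sub>i)) - \<theta>(x\<^sub>i)) \<theta>(y) = \<theta>(y) X\<^sub>i - X\<^sub>i \<theta>(y)\<close>.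
  As \<open>\<phi>(x\<^sub>i) x\<^sub>i\<^sup>-\<^sup>1\<close> lies in step \<open>m + 1\<close> of the lower central series, the difference on the left has order
  at least \<open>m + 1\<close> (\<open>theta_lcs\<close>), and \<open>\<theta>(y)\<close> has constant term 1. So the Johnson map and the commutator
  \<open>\<theta>(y) X\<^sub>i - X\<^sub>i \<theta>(y)\<close> agree in degree \<open>m + 1\<close> (\<open>theta_conjugate_leading\<close>). The coefficient of this
  commutator at \<open>J\<close> is the coefficient of \<open>\<theta>(y)\<close> at \<open>J\<close> without its last letter if that letter is \<open>i\<close>, minus
  the one at \<open>J\<close> without its first letter if that letter is \<open>i\<close>. These are the Milnor numbers in \<open>-\<mu>(J)\<close>.

  The real work is to show that the objects in this computation are well-defined: coordinates in \<open>H\<close>,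
  l-adic powers, and longitudes are all given by unique existence. The powers come from compactness
  (\<open>pro_pow_ex\<close>), the others are read off from the Magnus expansion. The main tool there is that a closed submonoid which contains the generators is the whole
  group (\<open>closed_submonoid_with_gens\<close>), a consequence of the density of polynomials among the
  power series. It yields that the coordinates in \<open>H\<close> are the linear coefficients of \<open>\<theta>\<close>
  (\<open>coordinates_iff\<close>), and that the centralizer of \<open>x\<^sub>i\<close> consists of the l-adic powers of \<open>x\<^sub>i\<close>
  (\<open>centralizer_gen\<close>), which gives the uniqueness of the longitude.\<close>

section \<open>The topology of the l-adic integers\<close>

lemma padic_res_mod: "n \<le> k \<Longrightarrow> padic_res (a :: 'l :: prime_card padic_int) k mod int CARD('l) ^ n = padic_res a n"
proof (induction k rule: dec_induct)
  case base
  have "padic_res a n = padic_res a (Suc n) mod int CARD('l) ^ n"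
    using padic_res[of a] by blast
  then show ?case by (metis mod_mod_trivial)
next
  case (step k)
  have eq: "padic_res a k = padic_res a (Suc k) mod int CARD('l) ^ k"
    using padic_res[of a] by blast
  have "int CARD('l) ^ n dvd int CARD('l) ^ k"
    using step.hyps by (simp add: le_imp_power_dvd)
  then have "padic_res a (Suc k) mod int CARD('l) ^ n = padic_res a k mod int CARD('l) ^ n"
    unfolding eq by (simp add: mod_mod_cancel)
  with step.IH show ?case by simp
qed

lemma padic_res_nonneg: "0 \<le> padic_res (a :: 'l :: prime_card padic_int) n"
proof -
  have "0 < int CARD('l) ^ n"
    using prime_gt_0_int[OF prime_card_int[where 'a = 'l]] by simp
  then show ?thesis
    using padic_res_mod[of n n a] pos_mod_sign[of "int CARD('l) ^ n" "padic_res a n"] by simp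
qed

lemma padic_eqI: "(\<And>n. padic_res a n = padic_res b n) \<Longrightarrow> a = b"
  by (simp add: padic_res_inject[symmetric] fun_eq_iff)

lemma padic_res_of_nat: "padic_res (of_nat k :: 'l :: prime_card padic_int) n = int k mod int CARD('l) ^ n"
proof (induction k)
  case 0
  show ?case by (simp add: zero_padic_int.rep_eq)
next
  case (Suc k)
  then show ?case
    by (simp add: plus_padic_int.rep_eq one_padic_int.rep_eq mod_add_eq add.commute)
qed

lemma topspace_padic [simp]: "topspace padic_topology = UNIV"
  by (simp add: padic_topology_def topspace_pullback_topology)

lemma continuous_map_discrete_UNIV:
  "continuous_map Z (discrete_topology UNIV) f \<longleftrightarrow> (\<forall>c. openin Z {x \<in> topspace Z. f x = c})"
proof
  assume "continuous_map Z (discrete_topology UNIV) f"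
  then show "\<forall>c. openin Z {x \<in> topspace Z. f x = c}"
    using openin_continuous_map_preimage[of Z "discrete_topology UNIV" f "{c}" for c] by simp
next
  assume *: "\<forall>c. openin Z {x \<in> topspace Z. f x = c}"
  show "continuous_map Z (discrete_topology UNIV) f"
    unfolding continuous_map
  proof (intro conjI allI impI)
    fix U :: "'b set"
    have "{x \<in> topspace Z. f x \<in> U} = (\<Union>c\<in>U. {x \<in> topspace Z. f x = c})"
      by auto
    then show "openin Z {x \<in> topspace Z. f x \<in> U}"
      using * by auto
  qed auto
qed

text \<open>Continuity into the l-adic integers is tested on residues, so that no metric is needed: every
  residue has to be a locally constant function.\<close>

lemma continuous_map_into_padic:
  "continuous_map Z padic_topology f \<longleftrightarrow> (\<forall>n c. openin Z {x \<in> topspace Z. padic_res (f x) n = c})"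
proof -
  have "continuous_map Z padic_topology f \<longleftrightarrow>
      continuous_map Z (product_topology (\<lambda>_. discrete_topology UNIV) UNIV) (padic_res \<circ> f)"
  proof
    assume "continuous_map Z padic_topology f"
    moreover have "continuous_map padic_topology (product_topology (\<lambda>_. discrete_topology UNIV) UNIV) (id \<circ> padic_res)"
      unfolding padic_topology_def by (rule continuous_map_pullback) simp
    ultimately show "continuous_map Z (product_topology (\<lambda>_. discrete_topology UNIV) UNIV) (padic_res \<circ> f)"
      using continuous_map_compose by fastforce
  next
    assume "continuous_map Z (product_topology (\<lambda>_. discrete_topology UNIV) UNIV) (padic_res \<circ> f)"
    then show "continuous_map Z padic_topology f"
      unfolding padic_topology_def by (rule continuous_map_pullback') simp
  qed
  also have "\<dots> \<longleftrightarrow> (\<forall>n. continuous_map Z (discrete_topology UNIV) (\<lambda>x. padic_res (f x) n))"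
    by (simp add: continuous_map_componentwise_UNIV)
  finally show ?thesis
    by (simp add: continuous_map_discrete_UNIV)
qed

lemma openin_padic_res: "openin padic_topology {a. padic_res a n = c}"
proof -
  have "continuous_map padic_topology padic_topology (\<lambda>a. a)" by simp
  then have "openin padic_topology {a \<in> topspace padic_topology. padic_res a n = c}"
    unfolding continuous_map_into_padic by blast
  then show ?thesis by simp
qed

lemma Hausdorff_space_padic: "Hausdorff_space (padic_topology :: 'l :: prime_card padic_int topology)"
  unfolding Hausdorff_space_def
proof (intro allI impI)
  fix a b :: "'l padic_int"
  assume "a \<in> topspace padic_topology \<and> b \<in> topspace padic_topology \<and> a \<noteq> b"
  then obtain n where n: "padic_res a n \<noteq> padic_res b n"
    using padic_eqI by blast
  show "\<exists>U V. openin padic_topology U \<and> openin padic_topology V \<and> a \<in> U \<and> b \<in> V \<and> disjnt U V"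
    by (intro exI[of _ "{x. padic_res x n = padic_res a n}"] exI[of _ "{x. padic_res x n = padic_res b n}"])
      (use n in \<open>auto simp: openin_padic_res disjnt_def\<close>)
qed

lemma closedin_padic_singleton: "closedin padic_topology {a}"
  by (simp add: closedin_Hausdorff_sing_eq Hausdorff_space_padic)

lemma limitin_padic_iff:
  "limitin padic_topology f a F \<longleftrightarrow> (\<forall>n. \<forall>\<^sub>F k in F. padic_res (f k) n = padic_res a n)"
proof
  assume "limitin padic_topology f a F"
  then show "\<forall>n. \<forall>\<^sub>F k in F. padic_res (f k) n = padic_res a n"
    using limitinD[of padic_topology f a F "{b. padic_res b n = padic_res a n}" for n] openin_padic_res
    by auto
next
  assume *: "\<forall>n. \<forall>\<^sub>F k in F. padic_res (f k) n = padic_res a n"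
  have "limitin (discrete_topology UNIV) (\<lambda>k. padic_res (f k) n) (padic_res a n) F" for n
    using * by (intro limitin_eventually) auto
  then have "limitin (product_topology (\<lambda>_. discrete_topology UNIV) UNIV) (\<lambda>k. padic_res (f k)) (padic_res a) F"
    by (simp add: limitin_componentwise)
  then show "limitin padic_topology f a F"
    unfolding limitin_def padic_topology_def
    by (auto simp: topspace_pullback_topology openin_pullback_topology)
qed

text \<open>These natural numbers are the exponents through which l-adic powers are defined; the convergence
  transports identities for natural powers to l-adic ones.\<close>

lemma padic_residues_converge:
  "limitin padic_topology (\<lambda>k. of_nat (nat (padic_res a k))) (a :: 'l :: prime_card padic_int) sequentially"
  unfolding limitin_padic_iff
proof
  fix n
  show "\<forall>\<^sub>F k in sequentially. padic_res (of_nat (nat (padic_res a k)) :: 'l padic_int) n = padic_res a n"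
    unfolding eventually_sequentially padic_res_of_nat
    by (rule exI[of _ n]) (simp add: padic_res_nonneg padic_res_mod)
qed

section \<open>Non-commutative power series\<close>

lemma nc_eqI: "(\<And>w. nc_coeff f w = nc_coeff h w) \<Longrightarrow> f = h"
  by (simp add: nc_coeff_inject[symmetric] fun_eq_iff)

lemma nc_coeff_add [simp]: "nc_coeff (f + h) w = nc_coeff f w + nc_coeff h w"
  by transfer simp

lemma nc_coeff_diff [simp]: "nc_coeff (f - h) w = nc_coeff f w - nc_coeff h w"
  by transfer simp

lemma nc_coeff_minus [simp]: "nc_coeff (- f) w = - nc_coeff f w"
  by transfer simp

lemma nc_coeff_zero [simp]: "nc_coeff 0 w = 0"
  by transfer simp

lemma nc_coeff_one: "nc_coeff 1 w = of_bool (w = [])"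
  by transfer simp

lemma nc_coeff_mult: "nc_coeff (f * h) w = (\<Sum>i = 0..length w. nc_coeff f (take i w) * nc_coeff h (drop i w))"
  by transfer simp

lemma nc_coeff_smult [simp]: "nc_coeff (nc_smult c f) w = c * nc_coeff f w"
  by transfer simp

lemma nc_coeff_mono: "nc_coeff (nc_mono J) w = of_bool (w = J)"
  by (simp add: nc_mono_def Abs_ncps_inverse)

lemma nc_coeff_X: "nc_coeff (nc_X i) w = of_bool (w = [i])"
  by (simp add: nc_X_def nc_coeff_mono)

lemma nc_coeff_sum [simp]: "nc_coeff (\<Sum>x\<in>A. f x) w = (\<Sum>x\<in>A. nc_coeff (f x) w)"
  by (induction A rule: infinite_finite_induct) auto

lemma nc_mono_Nil: "nc_mono [] = 1"
  by (rule nc_eqI) (simp add: nc_coeff_mono nc_coeff_one)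

lemma nc_coeff_X_mult:
  "nc_coeff (nc_X i * f) w = (if w \<noteq> [] \<and> hd w = i then nc_coeff f (tl w) else 0)"
proof (cases w)
  case Nil
  then show ?thesis by (simp add: nc_coeff_mult nc_coeff_X)
next
  case (Cons j v)
  have "nc_coeff (nc_X i * f) w
      = (\<Sum>k = 0..length w. if k = 1 then of_bool (j = i) * nc_coeff f v else 0)"
    unfolding nc_coeff_mult
  proof (rule sum.cong[OF refl])
    fix k assume "k \<in> {0..length w}"
    show "nc_coeff (nc_X i) (take k w) * nc_coeff f (drop k w)
        = (if k = 1 then of_bool (j = i) * nc_coeff f v else 0)"
      using \<open>k \<in> {0..length w}\<close>
      by (cases k; cases v; cases "k - 1") (simp_all add: Cons nc_coeff_X)
  qed
  then show ?thesis by (auto simp: Cons Suc_le_eq)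
qed

lemma nc_coeff_mult_X:
  "nc_coeff (f * nc_X i) w = (if w \<noteq> [] \<and> last w = i then nc_coeff f (butlast w) else 0)"
proof (cases w rule: rev_cases)
  case Nil
  then show ?thesis by (simp add: nc_coeff_mult nc_coeff_X)
next
  case (snoc v j)
  have "nc_coeff (f * nc_X i) w
      = (\<Sum>k = 0..length w. if k = length v then of_bool (j = i) * nc_coeff f v else 0)"
    unfolding nc_coeff_mult
  proof (rule sum.cong[OF refl])
    fix k assume k: "k \<in> {0..length w}"
    have "drop k (v @ [j]) = [i] \<longleftrightarrow> k = length v \<and> j = i"
    proof
      assume a: "drop k (v @ [j]) = [i]"
      then have "length (drop k (v @ [j])) = 1" by simp
      then have "k = length v" by simp
      with a show "k = length v \<and> j = i" by simp
    qed simp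
    then show "nc_coeff f (take k w) * nc_coeff (nc_X i) (drop k w)
        = (if k = length v then of_bool (j = i) * nc_coeff f v else 0)"
      by (auto simp: snoc nc_coeff_X)
  qed
  then show ?thesis by (simp add: snoc)
qed

lemma nc_mono_Cons: "nc_mono (i # w) = nc_X i * nc_mono w"
proof (rule nc_eqI)
  fix v show "nc_coeff (nc_mono (i # w)) v = nc_coeff (nc_X i * nc_mono w) v"
    by (cases v) (auto simp: nc_coeff_X_mult nc_coeff_mono)
qed

lemma nc_coeff_mult_Nil: "nc_coeff (f * h) [] = nc_coeff f [] * nc_coeff h []"
  by (simp add: nc_coeff_mult)

lemma nc_coeff_mult_single:
  "nc_coeff (f * h) [i] = nc_coeff f [] * nc_coeff h [i] + nc_coeff f [i] * nc_coeff h []"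
  by (simp add: nc_coeff_mult numeral_2_eq_2)

text \<open>The filtration of the completed tensor algebra by the powers of its augmentation ideal.\<close>

definition nc_order_ge :: "nat \<Rightarrow> ('a :: comm_ring_1) ncps set" where
  "nc_order_ge n = {f. \<forall>w. length w < n \<longrightarrow> nc_coeff f w = 0}"

lemma nc_order_ge_mult:
  assumes "f \<in> nc_order_ge m" "h \<in> nc_order_ge n"
  shows "f * h \<in> nc_order_ge (m + n)"
proof -
  have "nc_coeff (f * h) w = 0" if w: "length w < m + n" for w
    unfolding nc_coeff_mult
  proof (intro sum.neutral ballI)
    fix i assume "i \<in> {0..length w}"
    then have "length (take i w) < m \<or> length (drop i w) < n" using w by auto
    then show "nc_coeff f (take i w) * nc_coeff h (drop i w) = 0"
      using assms unfolding nc_order_ge_def by auto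
  qed
  then show ?thesis by (simp add: nc_order_ge_def)
qed

lemma nc_order_ge_mult_right: "f \<in> nc_order_ge m \<Longrightarrow> f * h \<in> nc_order_ge m"
  using nc_order_ge_mult[of f m h 0] by (simp add: nc_order_ge_def)

lemma nc_order_ge_zero: "0 \<in> nc_order_ge m"
  by (simp add: nc_order_ge_def)

lemma nc_order_ge_add: "f \<in> nc_order_ge m \<Longrightarrow> h \<in> nc_order_ge m \<Longrightarrow> f + h \<in> nc_order_ge m"
  by (simp add: nc_order_ge_def)

lemma nc_order_ge_diff: "f \<in> nc_order_ge m \<Longrightarrow> h \<in> nc_order_ge m \<Longrightarrow> f - h \<in> nc_order_ge m"
  by (simp add: nc_order_ge_def)

text \<open>This removes the factor \<open>\<theta>(y)\<^sup>-\<^sup>1\<close> when leading forms of conjugates are computed.\<close>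

lemma nc_coeff_mult_leading:
  assumes "f \<in> nc_order_ge n" "length w = n" "nc_coeff h [] = 1"
  shows "nc_coeff (f * h) w = nc_coeff f w"
proof -
  have "f * (h - 1) \<in> nc_order_ge (n + 1)"
    using assms by (intro nc_order_ge_mult) (auto simp: nc_order_ge_def nc_coeff_one)
  then have "nc_coeff (f * (h - 1)) w = 0"
    using assms(2) by (simp add: nc_order_ge_def)
  then show ?thesis by (simp add: algebra_simps)
qed

text \<open>Comparing coefficients in \<open>X\<^sub>i f = f X\<^sub>i\<close> gives two facts: a nonempty word with nonzero
  coefficient ends in \<open>i\<close>, and moving this last letter \<open>i\<close> to the front does not change the
  coefficient. Repeating both reads off every letter of the word.\<close>

lemma commutes_X_support:
  assumes comm: "nc_X i * f = f * nc_X i" and "nc_coeff f w \<noteq> 0"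
  shows "set w \<subseteq> {i}"
proof -
  have rot: "nc_coeff f (v @ [i]) = nc_coeff f (i # v)" for v
    using arg_cong[OF comm, of "\<lambda>s. nc_coeff s (i # v @ [i])"]
    by (simp add: nc_coeff_X_mult nc_coeff_mult_X butlast_append)
  have last: "last v = i" if "v \<noteq> []" "nc_coeff f v \<noteq> 0" for v
    using arg_cong[OF comm, of "\<lambda>s. nc_coeff s (i # v)"] that
    by (auto simp: nc_coeff_X_mult nc_coeff_mult_X split: if_splits)
  have "nc_coeff f (replicate n i @ w) \<noteq> 0 \<Longrightarrow> set w \<subseteq> {i}" for n
  proof (induction w arbitrary: n rule: rev_induct)
    case (snoc j v)
    then have "j = i" using last[of "replicate n i @ v @ [j]"] by simp
    then have "nc_coeff f (replicate (Suc n) i @ v) \<noteq> 0"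
      using snoc.prems rot[of "replicate n i @ v"] by simp
    with snoc.IH[of "Suc n"] \<open>j = i\<close> show ?case by simp
  qed simp
  from this[of 0] assms(2) show ?thesis by simp
qed

lemma topspace_nc [simp]: "topspace (nc_topology r) = nc_space r"
  by (simp add: nc_topology_def topspace_pullback_topology)

lemma continuous_map_nc_coeff: "continuous_map (nc_topology r) padic_topology (\<lambda>f. nc_coeff f w)"
proof -
  have "continuous_map (product_topology (\<lambda>_. padic_topology) UNIV) padic_topology (\<lambda>f. f w)"
    by (rule continuous_map_product_projection) simp
  then show ?thesis
    unfolding nc_topology_def
    by (drule_tac continuous_map_pullback) (simp add: o_def)
qed

lemma limitin_nc:
  assumes "a \<in> nc_space r" "\<And>k. f k \<in> nc_space r"
    and "\<And>w. limitin padic_topology (\<lambda>k. nc_coeff (f k) w) (nc_coeff a w) F"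
  shows "limitin (nc_topology r) f a F"
proof -
  have "limitin (product_topology (\<lambda>_. padic_topology) UNIV) (\<lambda>k. nc_coeff (f k)) (nc_coeff a) F"
    by (simp add: limitin_componentwise assms)
  then show ?thesis
    using assms(1,2) unfolding limitin_def nc_topology_def
    by (auto simp: topspace_pullback_topology openin_pullback_topology)
qed

lemma finite_words: "finite (words r n)"
  unfolding words_def using finite_lists_length_eq[of "{1..r}" n] by simp

text \<open>Every series is the limit of its truncations, which are finite linear combinations of monomials.\<close>

lemma nc_closed_span_monos:
  assumes closed: "closedin (nc_topology r) B"
    and add: "\<And>s t. s \<in> B \<Longrightarrow> t \<in> B \<Longrightarrow> s + t \<in> B"
    and smult: "\<And>c s. s \<in> B \<Longrightarrow> nc_smult c s \<in> B"
    and mono: "\<And>w. set w \<subseteq> {1..r} \<Longrightarrow> nc_mono w \<in> B"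
  shows "B = nc_space r"
proof
  show "B \<subseteq> nc_space r"
    using closedin_subset[OF closed] by simp
  have "nc_smult 0 (nc_mono []) \<in> B"
    by (intro smult mono) simp
  moreover have "nc_smult 0 (nc_mono []) = (0 :: 'a padic_int ncps)"
    by (rule nc_eqI) simp
  ultimately have zero: "0 \<in> B" by simp
  show "nc_space r \<subseteq> B"
  proof
    fix a :: "'a padic_int ncps"
    assume a: "a \<in> nc_space r"
    define W where "W n = (\<Union>k<n. words r k)" for n
    define p where "p n = (\<Sum>w\<in>W n. nc_smult (nc_coeff a w) (nc_mono w))" for n
    have fin: "finite (W n)" for n
      by (simp add: W_def finite_words)
    have "sum (\<lambda>w. nc_smult (nc_coeff a w) (nc_mono w)) V \<in> B" if "finite V" "V \<subseteq> W n" for V n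
      using that
    proof (induction V rule: finite_induct)
      case (insert w V)
      then show ?case by (auto simp: W_def words_def intro!: add smult mono)
    qed (simp add: zero)
    then have pB: "p n \<in> B" for n
      unfolding p_def using fin by blast
    have coeff: "nc_coeff (p n) w = nc_coeff a w" if "length w < n" for n w
    proof -
      have "nc_coeff (p n) w = (\<Sum>v\<in>W n. if v = w then nc_coeff a w else 0)"
        unfolding p_def nc_coeff_sum
        by (rule sum.cong) (auto simp: nc_coeff_mono)
      also have "\<dots> = (if w \<in> W n then nc_coeff a w else 0)"
        using fin by (simp add: sum.delta')
      also have "\<dots> = nc_coeff a w"
        using a that by (auto simp: W_def words_def nc_space_def)
      finally show ?thesis .
    qed
    have "limitin (nc_topology r) p a sequentially"
    proof (rule limitin_nc)
      fix w
      have "\<forall>\<^sub>F n in sequentially. nc_coeff (p n) w = nc_coeff a w"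
        unfolding eventually_sequentially by (rule exI[of _ "Suc (length w)"]) (simp add: coeff)
      then show "limitin padic_topology (\<lambda>k. nc_coeff (p k) w) (nc_coeff a w) sequentially"
        by (intro limitin_eventually) simp
    qed (use a pB \<open>B \<subseteq> nc_space r\<close> in auto)
    then show "a \<in> B"
      by (rule limitin_closedin) (use closed pB in auto)
  qed
qed

section \<open>Pro-l groups and l-adic powers\<close>

context group
begin

lemma rcos_eq_iff:
  assumes "subgroup N G" "f \<in> carrier G" "h \<in> carrier G"
  shows "N #> f = N #> h \<longleftrightarrow> f \<in> N #> h"
  using assms by (metis repr_independence rcos_self)

text \<open>Congruence modulo a normal subgroup is written as equality of right cosets throughout.\<close>

lemma rcos_cong_mult:
  assumes "N \<lhd> G" "f \<in> carrier G" "f' \<in> carrier G" "h \<in> carrier G" "h' \<in> carrier G"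
    and "N #> f = N #> f'" "N #> h = N #> h'"
  shows "N #> (f \<otimes> h) = N #> (f' \<otimes> h')"
  using assms normal.rcos_sum[of N G] by metis

lemma subgroup_nat_pow_closed:
  assumes "subgroup N G" "f \<in> N"
  shows "f [^] (k::nat) \<in> N"
  using assms by (induction k) (auto simp: subgroup.one_closed subgroup.m_closed)

lemma rcos_cong_pow:
  assumes "N \<lhd> G" "f \<in> carrier G" and pow: "f [^] (q::nat) \<in> N" and "a mod q = b mod q"
  shows "N #> f [^] a = N #> f [^] b"
proof -
  note sub = normal_imp_subgroup[OF \<open>N \<lhd> G\<close>]
  have "N #> f [^] c = N #> f [^] (c mod q)" for c
  proof -
    have "N #> f [^] (q * (c div q)) = N #> \<one>"
      using subgroup_nat_pow_closed[OF sub pow, of "c div q"] assms(2) sub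
      by (simp add: nat_pow_pow coset_join2 subgroup.subset)
    then have "N #> (f [^] (q * (c div q)) \<otimes> f [^] (c mod q)) = N #> (\<one> \<otimes> f [^] (c mod q))"
      using assms(1,2) by (intro rcos_cong_mult) auto
    then show ?thesis using assms(2) by (simp add: nat_pow_mult)
  qed
  from this[of a] this[of b] show ?thesis using assms(4) by simp
qed

lemma commutator_closed_subgroup_normal:
  assumes sub: "subgroup L G"
    and comm: "\<And>a b. a \<in> L \<Longrightarrow> b \<in> carrier G \<Longrightarrow> b \<otimes> a \<otimes> inv b \<otimes> inv a \<in> L"
  shows "L \<lhd> G"
  unfolding normal_inv_iff
proof (intro conjI ballI sub)
  fix b a assume b: "b \<in> carrier G" and a: "a \<in> L"
  have "b \<otimes> a \<otimes> inv b = (b \<otimes> a \<otimes> inv b \<otimes> inv a) \<otimes> a"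
    using b subgroup.mem_carrier[OF sub a] by (simp add: m_assoc)
  also have "\<dots> \<in> L"
    using comm[OF a b] a sub by (simp add: subgroup.m_closed)
  finally show "b \<otimes> a \<otimes> inv b \<in> L" .
qed

end

locale pro_l_group = group G for G :: "('a, 'b) monoid_scheme" (structure) +
  fixes T :: "'a topology" and lt :: "'l :: prime_card itself"
  assumes pro: "pro_group CARD('l) G T"
begin

lemma topspace_T [simp]: "topspace T = carrier G"
  using pro by (simp add: pro_group_def)

lemma compact_T: "compact_space T"
  using pro by (simp add: pro_group_def)

lemma Hausdorff_T: "Hausdorff_space T"
  using pro by (simp add: pro_group_def)

lemma continuous_mult:
  assumes "continuous_map Z T f" "continuous_map Z T h"
  shows "continuous_map Z T (\<lambda>z. f z \<otimes> h z)"
proof -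
  have "continuous_map (prod_topology T T) T (\<lambda>(a, b). a \<otimes> b)"
    using pro by (simp add: pro_group_def)
  from continuous_map_compose[OF continuous_map_pairedI[OF assms] this]
  show ?thesis by (simp add: o_def)
qed

lemma continuous_inv: 
  assumes "continuous_map Z T f"
  shows "continuous_map Z T (\<lambda>z. inv (f z))"
proof -
  have "continuous_map T T (\<lambda>a. inv a)"
    using pro by (simp add: pro_group_def)
  from continuous_map_compose[OF assms this] show ?thesis by (simp add: o_def)
qed

lemma continuous_const: "c \<in> carrier G \<Longrightarrow> continuous_map Z T (\<lambda>_. c)"
  by simp

text \<open>The open normal subgroups of l-power index. The exponent of the index is kept because residues
  modulo \<open>l\<^sup>n\<close> determine l-adic powers modulo such a subgroup.\<close>

definition pnormals :: "(nat \<times> 'a set) set" where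
  "pnormals = {(n, N). N \<in> open_normals G T \<and> card (rcosets N) = CARD('l) ^ n}"

lemma pnormalsD:
  assumes "(n, N) \<in> pnormals"
  shows "N \<in> open_normals G T" "N \<lhd> G" "subgroup N G" "N \<subseteq> carrier G" "openin T N"
    "card (rcosets N) = CARD('l) ^ n"
  using assms by (auto simp: pnormals_def open_normals_def normal_imp_subgroup dest!: normal_imp_subgroup subgroup.subset)

lemma pnormal_nbhd:
  assumes "openin T U" "f \<in> U"
  obtains n N where "(n, N) \<in> pnormals" "N #> f \<subseteq> U"
proof -
  have f: "f \<in> carrier G"
    using openin_subset[OF assms(1)] assms(2) by auto
  let ?V = "{u \<in> topspace T. u \<otimes> f \<in> U}"
  have "continuous_map T T (\<lambda>u. u \<otimes> f)"
    by (intro continuous_mult continuous_const f) simp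
  then have "openin T ?V" using assms(1) by (rule openin_continuous_map_preimage)
  moreover have "\<one> \<in> ?V" using f assms(2) by simp
  ultimately obtain N n where N: "N \<in> open_normals G T" "N \<subseteq> ?V" "card (rcosets N) = CARD('l) ^ n"
    using pro unfolding pro_group_def by meson
  show thesis
  proof
    show "(n, N) \<in> pnormals" using N by (simp add: pnormals_def)
    show "N #> f \<subseteq> U" using N(2) by (auto simp: r_coset_def)
  qed
qed

lemma openin_coset:
  assumes "N \<in> open_normals G T" "f \<in> carrier G"
  shows "openin T (N #> f)"
proof -
  have N: "N \<lhd> G" "openin T N" using assms by (auto simp: open_normals_def)
  note sub = normal_imp_subgroup[OF N(1)]
  have "continuous_map T T (\<lambda>u. u \<otimes> inv f)"
    using assms(2) by (intro continuous_mult continuous_const) auto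
  then have "openin T {u \<in> topspace T. u \<otimes> inv f \<in> N}"
    using N(2) by (rule openin_continuous_map_preimage)
  also have "{u \<in> topspace T. u \<otimes> inv f \<in> N} = N #> f"
    using subgroup.rcos_module[OF sub is_group assms(2)] subgroup.elemrcos_carrier[OF sub is_group assms(2)]
    by auto
  finally show ?thesis .
qed

lemma closedin_coset:
  assumes "N \<in> open_normals G T" "f \<in> carrier G"
  shows "closedin T (N #> f)"
proof -
  have sub: "subgroup N G" using assms by (auto simp: open_normals_def normal_imp_subgroup)
  have "carrier G - (N #> f) = \<Union> {N #> h | h. h \<in> carrier G \<and> h \<notin> N #> f}"
  proof (intro equalityI subsetI)
    fix u assume "u \<in> carrier G - (N #> f)"
    then show "u \<in> \<Union> {N #> h | h. h \<in> carrier G \<and> h \<notin> N #> f}"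
      using rcos_self[OF _ sub] by blast
  next
    fix u assume "u \<in> \<Union> {N #> h | h. h \<in> carrier G \<and> h \<notin> N #> f}"
    then obtain h where h: "h \<in> carrier G" "h \<notin> N #> f" "u \<in> N #> h" by blast
    have u: "u \<in> carrier G" using h subgroup.elemrcos_carrier[OF sub is_group] by blast
    with h show "u \<in> carrier G - (N #> f)"
      using rcos_eq_iff[OF sub] assms(2) by blast
  qed
  moreover have "openin T (\<Union> {N #> h | h. h \<in> carrier G \<and> h \<notin> N #> f})"
    using openin_coset[OF assms(1)] by auto
  ultimately show ?thesis
    using subgroup.elemrcos_carrier[OF sub is_group assms(2)] by (auto simp: closedin_def)
qed

text \<open>Equalities in a pro-l group are proved modulo every open normal subgroup of l-power index.\<close>

lemma pnormal_separates:
  assumes "f \<in> carrier G" "h \<in> carrier G"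
    and eq: "\<And>n N. (n, N) \<in> pnormals \<Longrightarrow> N #> f = N #> h"
  shows "f = h"
proof (rule ccontr)
  assume "f \<noteq> h"
  then obtain U V where U: "openin T U" "f \<in> U" "h \<notin> U"
    using Hausdorff_T assms(1,2) unfolding Hausdorff_space_def disjnt_def
    by (metis (no_types, lifting) IntI empty_iff topspace_T)
  obtain n N where N: "(n, N) \<in> pnormals" "N #> f \<subseteq> U"
    using pnormal_nbhd[OF U(1,2)] .
  have "h \<in> N #> f"
    using eq[OF N(1)] assms pnormalsD(3)[OF N(1)] by (simp add: rcos_self)
  with N(2) U(3) show False by blast
qed

text \<open>The cosets of the open normal subgroups of l-power index form neighbourhood bases, so closures can be
  computed in finite l-groups.\<close>

lemma in_closure_iff:
  assumes "S \<subseteq> carrier G"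
  shows "f \<in> Abstract_Topology.closure_of T S \<longleftrightarrow>
    f \<in> carrier G \<and> (\<forall>n N. (n, N) \<in> pnormals \<longrightarrow> (\<exists>s\<in>S. s \<in> N #> f))"
proof
  assume f: "f \<in> Abstract_Topology.closure_of T S"
  then have c: "f \<in> carrier G" by (simp add: in_closure_of)
  moreover have "\<exists>s\<in>S. s \<in> N #> f" if "(n, N) \<in> pnormals" for n N
    using f openin_coset[OF pnormalsD(1)[OF that] c] rcos_self[OF c pnormalsD(3)[OF that]]
    by (auto simp: in_closure_of)
  ultimately show "f \<in> carrier G \<and> (\<forall>n N. (n, N) \<in> pnormals \<longrightarrow> (\<exists>s\<in>S. s \<in> N #> f))" by blast
next
  assume *: "f \<in> carrier G \<and> (\<forall>n N. (n, N) \<in> pnormals \<longrightarrow> (\<exists>s\<in>S. s \<in> N #> f))"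
  show "f \<in> Abstract_Topology.closure_of T S"
    unfolding in_closure_of
  proof (intro conjI allI impI)
    fix U assume "f \<in> U \<and> openin T U"
    then obtain n N where "(n, N) \<in> pnormals" "N #> f \<subseteq> U"
      using pnormal_nbhd by blast
    then show "\<exists>y. y \<in> S \<and> y \<in> U" using * by blast
  qed (use * in simp)
qed

lemma closure_subgroup:
  assumes S: "subgroup S G"
  shows "subgroup (Abstract_Topology.closure_of T S) G"
proof -
  note iff = in_closure_iff[OF subgroup.subset[OF S]]
  show ?thesis
  proof (rule subgroup.intro)
    show "Abstract_Topology.closure_of T S \<subseteq> carrier G" using iff by blast
    show "\<one> \<in> Abstract_Topology.closure_of T S"
      unfolding iff using subgroup.one_closed[OF S] rcos_self pnormalsD(3) one_closed by metis
  next
    fix f h assume f: "f \<in> Abstract_Topology.closure_of T S" and h: "h \<in> Abstract_Topology.closure_of T S"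
    have c: "f \<in> carrier G" "h \<in> carrier G" using f h iff by auto
    have "\<exists>s\<in>S. s \<in> N #> (f \<otimes> h)" if N: "(n, N) \<in> pnormals" for n N
    proof -
      obtain s t where st: "s \<in> S" "t \<in> S" "s \<in> N #> f" "t \<in> N #> h"
        using f h N iff by meson
      have "s \<in> carrier G" "t \<in> carrier G" using st subgroup.mem_carrier[OF S] by auto
      then have "N #> (s \<otimes> t) = N #> (f \<otimes> h)"
        using st c pnormalsD[OF N] rcos_eq_iff by (intro rcos_cong_mult) auto
      then show ?thesis
        using st subgroup.m_closed[OF S] rcos_self pnormalsD(3)[OF N] subgroup.mem_carrier[OF S] by metis
    qed
    then show "f \<otimes> h \<in> Abstract_Topology.closure_of T S"
      unfolding iff using c by auto
  next
    fix f assume f: "f \<in> Abstract_Topology.closure_of T S"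
    have c: "f \<in> carrier G" using f iff by auto
    have "\<exists>s\<in>S. s \<in> N #> inv f" if N: "(n, N) \<in> pnormals" for n N
    proof -
      obtain s where s: "s \<in> S" "s \<in> N #> f"
        using f N iff by meson
      have sc: "s \<in> carrier G" using s subgroup.mem_carrier[OF S] by auto
      have "N #> s = N #> f" using s c sc pnormalsD[OF N] rcos_eq_iff by auto
      then have "N #> inv s = N #> inv f"
        using normal.rcos_inv[OF pnormalsD(2)[OF N]] sc c by metis
      then show ?thesis
        using s subgroup.m_inv_closed[OF S] rcos_self pnormalsD(3)[OF N] subgroup.mem_carrier[OF S] by metis
    qed
    then show "inv f \<in> Abstract_Topology.closure_of T S"
      unfolding iff using c by auto
  qed
qed

lemma pnormal_pow_mem:
  assumes "(n, N) \<in> pnormals" "f \<in> carrier G"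
  shows "f [^] (CARD('l) ^ n) \<in> N"
proof -
  note N = pnormalsD[OF assms(1)]
  interpret Q: group "G Mod N" by (rule normal.factorgroup_is_group[OF N(2)])
  have "order (G Mod N) = CARD('l) ^ n"
    using N(6) by (simp add: order_def FactGroup_def)
  moreover have "N #> f \<in> carrier (G Mod N)"
    using assms(2) by (simp add: carrier_FactGroup)
  ultimately have "(N #> f) [^]\<^bsub>G Mod N\<^esub> (CARD('l) ^ n) = \<one>\<^bsub>G Mod N\<^esub>"
    using Q.pow_order_eq_1 by metis
  then have "N #> f [^] (CARD('l) ^ n) = N"
    using normal.FactGroup_pow[OF N(2) assms(2)] by simp
  then show ?thesis
    using rcos_self[OF _ N(3), of "f [^] (CARD('l) ^ n)"] assms(2) by simp
qed

lemma pnormal_cong_pow: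
  assumes "(n, N) \<in> pnormals" "f \<in> carrier G" "a mod CARD('l) ^ n = b mod CARD('l) ^ n"
  shows "N #> f [^] a = N #> f [^] b"
  using rcos_cong_pow[OF pnormalsD(2)[OF assms(1)] assms(2) pnormal_pow_mem[OF assms(1,2)] assms(3)] .

lemma pnormal_cong_residue:
  assumes "(n, N) \<in> pnormals" "f \<in> carrier G" "n \<le> k"
  shows "N #> f [^] nat (padic_res (c :: 'l padic_int) k) = N #> f [^] nat (padic_res c n)"
proof (rule pnormal_cong_pow[OF assms(1,2)])
  have "int (nat (padic_res c k) mod CARD('l) ^ n) = int (nat (padic_res c n) mod CARD('l) ^ n)"
    by (simp only: zmod_int of_nat_power nat_0_le[OF padic_res_nonneg] padic_res_mod[OF assms(3)]
        padic_res_mod[OF order_refl])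
  then show "nat (padic_res c k) mod CARD('l) ^ n = nat (padic_res c n) mod CARD('l) ^ n"
    by (simp only: of_nat_eq_iff)
qed

text \<open>The cosets \<open>N f\<^sup>k\<close>, with \<open>k\<close> the residue of \<open>c\<close> modulo the index of \<open>N\<close>, are closed, and a residue
  of \<open>c\<close> modulo a high power of \<open>l\<close> gives a point in any finite number of them. By compactness they have
  a common point, and this point is the limit which defines the power.\<close>

lemma pro_pow_ex:
  assumes f: "f \<in> carrier G"
  shows "\<exists>z\<in>carrier G. (\<forall>n N. (n, N) \<in> pnormals \<longrightarrow> N #> z = N #> f [^] nat (padic_res (c :: 'l padic_int) n)) \<and>
     limitin T (\<lambda>k. f [^] nat (padic_res c k)) z sequentially"
proof -
  define C where "C = (\<lambda>(n, N). N #> f [^] nat (padic_res c n))"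
  have "\<Inter>(insert (carrier G) (C ` pnormals)) \<noteq> {}"
  proof (rule compact_space_fip[THEN iffD1, OF compact_T, rule_format], intro conjI ballI allI impI)
    fix A assume "A \<in> insert (carrier G) (C ` pnormals)"
    then show "closedin T A"
      using f closedin_coset pnormalsD(1) closedin_topspace[of T] by (auto simp: C_def)
  next
    fix F assume "finite F \<and> F \<subseteq> insert (carrier G) (C ` pnormals)"
    then have "finite (F - {carrier G})" "F - {carrier G} \<subseteq> C ` pnormals" by auto
    then obtain P where P: "finite P" "P \<subseteq> pnormals" "F - {carrier G} = C ` P"
      using finite_subset_image by meson
    define k where "k = Max (insert 0 (fst ` P))"
    have "f [^] nat (padic_res c k) \<in> A" if A: "A \<in> F" for A
    proof (cases "A = carrier G")
      case False
      then have "A \<in> C ` P" using A unfolding P(3)[symmetric] by blast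
      then obtain n N where nN: "(n, N) \<in> P" "A = N #> f [^] nat (padic_res c n)"
        by (auto simp: C_def)
      have "n \<in> fst ` P" using nN(1) by (rule image_eqI[rotated]) simp
      then have "n \<le> k" using P(1) unfolding k_def by (intro Max_ge) auto
      moreover have N: "(n, N) \<in> pnormals" using nN(1) P(2) by blast
      ultimately have "A = N #> f [^] nat (padic_res c k)"
        using pnormal_cong_residue[OF N f, of k c] nN(2) by simp
      then show ?thesis
        using rcos_self[OF nat_pow_closed[OF f] pnormalsD(3)[OF N]] by simp
    qed (use f in simp)
    then show "\<Inter> F \<noteq> {}" by blast
  qed
  then obtain z where z: "z \<in> carrier G" "\<And>n N. (n, N) \<in> pnormals \<Longrightarrow> z \<in> N #> f [^] nat (padic_res c n)"
    by (auto simp: C_def)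
  then have zN: "N #> z = N #> f [^] nat (padic_res c n)" if "(n, N) \<in> pnormals" for n N
    using that rcos_eq_iff[OF pnormalsD(3)[OF that]] f by simp
  have "limitin T (\<lambda>k. f [^] nat (padic_res c k)) z sequentially"
    unfolding limitin_sequentially
  proof (intro conjI allI impI)
    fix U assume "openin T U \<and> z \<in> U"
    then obtain n N where N: "(n, N) \<in> pnormals" "N #> z \<subseteq> U"
      using pnormal_nbhd by blast
    have "f [^] nat (padic_res c k) \<in> U" if "n \<le> k" for k
    proof -
      have "N #> z = N #> f [^] nat (padic_res c k)"
        using pnormal_cong_residue[OF N(1) f that, of c] zN[OF N(1)] by simp
      then show ?thesis
        using N(2) rcos_self[OF nat_pow_closed[OF f] pnormalsD(3)[OF N(1)]] by blast
    qed
    then show "\<exists>n. \<forall>k\<ge>n. f [^] nat (padic_res c k) \<in> U" by blast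
  qed (use z in simp)
  with z zN show ?thesis by blast
qed

lemma pro_pow_props:
  assumes f: "f \<in> carrier G"
  shows "pro_pow G T f (c :: 'l padic_int) \<in> carrier G"
    and "(n, N) \<in> pnormals \<Longrightarrow> N #> pro_pow G T f c = N #> f [^] nat (padic_res c n)"
    and "limitin T (\<lambda>k. f [^] nat (padic_res c k)) (pro_pow G T f c) sequentially"
proof -
  obtain z where z: "z \<in> carrier G"
      "\<And>n N. (n, N) \<in> pnormals \<Longrightarrow> N #> z = N #> f [^] nat (padic_res c n)"
      "limitin T (\<lambda>k. f [^] nat (padic_res c k)) z sequentially"
    using pro_pow_ex[OF f, of c] by metis
  have "pro_pow G T f c = z"
    unfolding pro_pow_def
  proof (rule the_equality, rule z(3))
    fix y assume "limitin T (\<lambda>k. f [^] nat (padic_res c k)) y sequentially"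
    then show "y = z"
      by (rule limitin_Hausdorff_unique[OF _ z(3) trivial_limit_sequentially Hausdorff_T])
  qed
  with z show "pro_pow G T f c \<in> carrier G"
    "(n, N) \<in> pnormals \<Longrightarrow> N #> pro_pow G T f c = N #> f [^] nat (padic_res c n)"
    "limitin T (\<lambda>k. f [^] nat (padic_res c k)) (pro_pow G T f c) sequentially"
    by (simp_all only:)
qed

lemma pro_pow_add:
  assumes f: "f \<in> carrier G"
  shows "pro_pow G T f (c + d :: 'l padic_int) = pro_pow G T f c \<otimes> pro_pow G T f d"
proof (rule pnormal_separates)
  fix n N assume N: "(n, N) \<in> pnormals"
  have "int (nat (padic_res (c + d) n) mod CARD('l) ^ n) = int ((nat (padic_res c n) + nat (padic_res d n)) mod CARD('l) ^ n)"
    by (simp only: zmod_int of_nat_add of_nat_power nat_0_le[OF padic_res_nonneg])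
      (simp only: plus_padic_int.rep_eq mod_mod_trivial)
  then have *: "nat (padic_res (c + d) n) mod CARD('l) ^ n = (nat (padic_res c n) + nat (padic_res d n)) mod CARD('l) ^ n"
    by (simp only: of_nat_eq_iff)
  have "N #> pro_pow G T f (c + d) = N #> f [^] nat (padic_res (c + d) n)"
    by (rule pro_pow_props(2)[OF f N])
  also have "\<dots> = N #> (f [^] nat (padic_res c n) \<otimes> f [^] nat (padic_res d n))"
    using pnormal_cong_pow[OF N f *] f by (simp add: nat_pow_mult)
  also have "\<dots> = N #> (pro_pow G T f c \<otimes> pro_pow G T f d)"
    using pnormalsD[OF N] f pro_pow_props(1,2)[OF f] N by (intro rcos_cong_mult) auto
  finally show "N #> pro_pow G T f (c + d) = N #> (pro_pow G T f c \<otimes> pro_pow G T f d)" .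
qed (simp_all only: f pro_pow_props(1) m_closed)

lemma pro_pow_of_nat:
  assumes f: "f \<in> carrier G"
  shows "pro_pow G T f (of_nat k :: 'l padic_int) = f [^] k"
proof (rule pnormal_separates)
  fix n N assume N: "(n, N) \<in> pnormals"
  have "N #> pro_pow G T f (of_nat k :: 'l padic_int) = N #> f [^] nat (padic_res (of_nat k :: 'l padic_int) n)"
    by (rule pro_pow_props(2)[OF f N])
  also have "\<dots> = N #> f [^] k"
  proof (rule pnormal_cong_pow[OF N f])
    have "nat (padic_res (of_nat k :: 'l padic_int) n) = k mod CARD('l) ^ n"
      by (simp only: padic_res_of_nat of_nat_power[symmetric] zmod_int[symmetric] nat_int)
    then show "nat (padic_res (of_nat k :: 'l padic_int) n) mod CARD('l) ^ n = k mod CARD('l) ^ n"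
      by (simp only: mod_mod_trivial)
  qed
  finally show "N #> pro_pow G T f (of_nat k :: 'l padic_int) = N #> f [^] k" .
qed (simp_all only: f pro_pow_props(1) nat_pow_closed)

lemma pro_pow_0: "f \<in> carrier G \<Longrightarrow> pro_pow G T f (0 :: 'l padic_int) = \<one>"
  using pro_pow_of_nat[of f 0] by simp

lemma pro_pow_1: "f \<in> carrier G \<Longrightarrow> pro_pow G T f (1 :: 'l padic_int) = f"
  using pro_pow_of_nat[of f 1] by simp

lemma continuous_pro_pow:
  assumes f: "f \<in> carrier G"
  shows "continuous_map padic_topology T (pro_pow G T f :: 'l padic_int \<Rightarrow> 'a)"
  unfolding continuous_map
proof (intro conjI allI impI)
  show "pro_pow G T f ` topspace (padic_topology :: 'l padic_int topology) \<subseteq> topspace T"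
    unfolding image_subset_iff topspace_T using pro_pow_props(1)[OF f] by blast
next
  fix U assume U: "openin T U"
  show "openin padic_topology {c \<in> topspace (padic_topology :: 'l padic_int topology). pro_pow G T f c \<in> U}"
  proof (rule openin_subopen[THEN iffD2], intro ballI)
    fix c assume "c \<in> {c \<in> topspace (padic_topology :: 'l padic_int topology). pro_pow G T f c \<in> U}"
    then obtain n N where N: "(n, N) \<in> pnormals" "N #> pro_pow G T f c \<subseteq> U"
      using pnormal_nbhd[OF U] by blast
    have "pro_pow G T f d \<in> U" if "padic_res d n = padic_res c n" for d :: "'l padic_int"
    proof -
      have "N #> pro_pow G T f d = N #> pro_pow G T f c"
        using pro_pow_props(2)[OF f N(1)] that by metis
      then show ?thesis
        using N(2) rcos_self[OF pro_pow_props(1)[OF f] pnormalsD(3)[OF N(1)]] by blast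
    qed
    then show "\<exists>V. openin padic_topology V \<and> c \<in> V \<and>
        V \<subseteq> {c \<in> topspace (padic_topology :: 'l padic_int topology). pro_pow G T f c \<in> U}"
      by (intro exI[of _ "{d. padic_res d n = padic_res c n}"]) (auto simp: openin_padic_res)
  qed
qed

end

section \<open>Group elements in the completed group algebra\<close>

context pro_l_group
begin

abbreviation (input) "GA \<equiv> group_algebra G T :: ('a set \<Rightarrow> 'l padic_int) set"

abbreviation ge :: "'a \<Rightarrow> 'a set \<Rightarrow> 'l padic_int" where
  "ge \<equiv> group_element G T"

lemma open_normalsD:
  assumes "N \<in> open_normals G T"
  shows "N \<lhd> G" "subgroup N G" "N \<subseteq> carrier G" "openin T N"
  using assms by (auto simp: open_normals_def normal_imp_subgroup dest!: normal_imp_subgroup subgroup.subset)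

text \<open>Finiteness is needed because the compatibility condition and the product of the group algebra are
  sums over cosets, which would be 0 for infinite index. It holds because an open subgroup contains one of l-power index.\<close>

lemma finite_rcosets:
  assumes N: "N \<in> open_normals G T"
  shows "finite (rcosets N)"
proof -
  note N' = open_normalsD[OF N]
  obtain n M where M: "(n, M) \<in> pnormals" "M #> \<one> \<subseteq> N"
    using pnormal_nbhd[OF N'(4) subgroup.one_closed[OF N'(2)]] .
  then have sub: "M \<subseteq> N"
    using coset_mult_one[OF pnormalsD(4)[OF M(1)]] by simp
  have "finite (rcosets M)"
    using pnormalsD(6)[OF M(1)] prime_gt_0_nat[OF prime_card[where 'a = 'l]]
    by (intro card_ge_0_finite) simp
  moreover have "rcosets N \<subseteq> (\<lambda>C. N #> (SOME f. f \<in> C)) ` (rcosets M)"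
  proof
    fix C assume "C \<in> rcosets N"
    then obtain f where f: "f \<in> carrier G" "C = N #> f" by (auto simp: RCOSETS_def)
    define h where "h = (SOME h. h \<in> M #> f)"
    have "h \<in> M #> f"
      unfolding h_def using rcos_self[OF f(1) pnormalsD(3)[OF M(1)]] by (rule someI)
    then have "h \<in> N #> f" using sub by (auto simp: r_coset_def)
    then have "C = N #> h"
      using f repr_independence N'(2) by blast
    moreover have "M #> f \<in> rcosets M"
      using f(1) pnormalsD(4)[OF M(1)] rcosetsI by blast
    ultimately show "C \<in> (\<lambda>C. N #> (SOME f. f \<in> C)) ` (rcosets M)"
      unfolding h_def by blast
  qed
  ultimately show ?thesis
    using finite_surj by blast
qed

lemma open_cosetsI: "N \<in> open_normals G T \<Longrightarrow> f \<in> carrier G \<Longrightarrow> N #> f \<in> open_cosets G T"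
  unfolding open_cosets_def using rcosetsI open_normalsD(3) by blast

lemma open_cosetsE:
  assumes "C \<in> open_cosets G T"
  obtains N f where "N \<in> open_normals G T" "f \<in> carrier G" "C = N #> f"
  using assms unfolding open_cosets_def RCOSETS_def by blast

lemma group_element_coset:
  assumes "N \<in> open_normals G T" "f \<in> carrier G" "h \<in> carrier G"
  shows "ge f (N #> h) = of_bool (N #> f = N #> h)"
  using open_cosetsI[OF assms(1,3)] rcos_eq_iff[OF open_normalsD(2)[OF assms(1)] assms(2,3)]
  by (simp add: group_element_def)

text \<open>The product in the group algebra recovers the normal subgroup from a coset by this formula.\<close>

lemma coset_normal_coset:
  assumes "N \<in> open_normals G T" "f \<in> carrier G"
  shows "coset_normal G (N #> f) = N"
proof
  note N = open_normalsD[OF assms(1)]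
  show "coset_normal G (N #> f) \<subseteq> N"
  proof
    fix a assume "a \<in> coset_normal G (N #> f)"
    then obtain u v where uv: "a = u \<otimes> inv v" "u \<in> N #> f" "v \<in> N #> f"
      by (auto simp: coset_normal_def)
    have c: "u \<in> carrier G" "v \<in> carrier G"
      using uv subgroup.elemrcos_carrier[OF N(2) is_group assms(2)] by auto
    have "u \<in> N #> v"
      using uv c assms(2) N(2) rcos_eq_iff[OF N(2)] by metis
    then show "a \<in> N"
      using uv(1) subgroup.rcos_module_imp[OF N(2) is_group c(2)] by simp
  qed
  show "N \<subseteq> coset_normal G (N #> f)"
  proof
    fix a assume a: "a \<in> N"
    have c: "a \<in> carrier G" using a N(3) by blast
    have "a = (a \<otimes> f) \<otimes> inv f" using c assms(2) by (simp add: m_assoc)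
    moreover have "a \<otimes> f \<in> N #> f" using a N(3) assms(2) by (rule rcosI)
    ultimately show "a \<in> coset_normal G (N #> f)"
      unfolding coset_normal_def using rcos_self[OF assms(2) N(2)] by blast
  qed
qed

lemma group_element_in_algebra:
  assumes f: "f \<in> carrier G"
  shows "ge f \<in> GA"
  unfolding group_algebra_def
proof (intro CollectI conjI allI impI ballI)
  fix N N' C assume N: "N \<in> open_normals G T" and N': "N' \<in> open_normals G T" and "N' \<subseteq> N"
    and C: "C \<in> rcosets N"
  note D = open_normalsD[OF N] and D' = open_normalsD[OF N']
  obtain h where h: "h \<in> carrier G" "C = N #> h" using C by (auto simp: RCOSETS_def)
  let ?S = "{C' \<in> rcosets N'. C' \<subseteq> C}"
  have "finite ?S" using finite_rcosets[OF N'] by simp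
  have "ge f C' = (if C' = N' #> f then 1 else 0)" if "C' \<in> ?S" for C'
  proof -
    have "C' \<in> rcosets N'" using that by simp
    then obtain h' where h': "h' \<in> carrier G" "C' = N' #> h'" by (auto simp: RCOSETS_def)
    then show ?thesis using group_element_coset[OF N' f h'(1)] by auto
  qed
  then have "(\<Sum>C'\<in>?S. ge f C') = (\<Sum>C'\<in>?S. if C' = N' #> f then 1 else 0)"
    by (intro sum.cong) auto
  also have "\<dots> = of_bool (N' #> f \<in> ?S)"
    using \<open>finite ?S\<close> by simp
  also have "N' #> f \<in> ?S \<longleftrightarrow> N #> f = N #> h"
  proof
    assume "N' #> f \<in> ?S"
    then have "f \<in> N #> h" using rcos_self[OF f D'(2)] h(2) by blast
    then show "N #> f = N #> h" using rcos_eq_iff[OF D(2) f h(1)] by simp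
  next
    assume "N #> f = N #> h"
    moreover have "N' #> f \<subseteq> N #> f" using \<open>N' \<subseteq> N\<close> by (auto simp: r_coset_def)
    ultimately show "N' #> f \<in> ?S" using h(2) rcosetsI[OF D'(3) f] by simp
  qed
  finally show "ge f C = (\<Sum>C'\<in>?S. ge f C')"
    using group_element_coset[OF N f h(1)] h(2) by simp
qed (simp add: group_element_def)

lemma group_element_mult:
  assumes f: "f \<in> carrier G" and h: "h \<in> carrier G"
  shows "group_algebra_mult G T (ge f) (ge h) = ge (f \<otimes> h)"
proof
  fix C
  show "group_algebra_mult G T (ge f) (ge h) C = ge (f \<otimes> h) C"
  proof (cases "C \<in> open_cosets G T")
    case False
    then show ?thesis by (simp add: group_algebra_mult_def group_element_def)
  next
    case True
    then obtain N c where N: "N \<in> open_normals G T" and c: "c \<in> carrier G" "C = N #> c"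
      by (rule open_cosetsE)
    note D = open_normalsD[OF N]
    let ?S = "{(A, B). A \<in> rcosets N \<and> B \<in> rcosets N \<and> A <#> B = C}"
    have "?S \<subseteq> (rcosets N) \<times> (rcosets N)" by auto
    then have fin: "finite ?S"
      using finite_rcosets[OF N] finite_subset by blast
    have "(\<Sum>(A, B) \<in> ?S. ge f A * ge h B) = (\<Sum>p\<in>?S. if p = (N #> f, N #> h) then 1 else 0)"
    proof (rule sum.cong[OF refl])
      fix p assume "p \<in> ?S"
      then obtain a b where "a \<in> carrier G" "b \<in> carrier G" "p = (N #> a, N #> b)"
        by (auto simp: RCOSETS_def)
      then show "(case p of (A, B) \<Rightarrow> ge f A * ge h B) = (if p = (N #> f, N #> h) then 1 else 0)"
        using group_element_coset[OF N f] group_element_coset[OF N h] by auto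
    qed
    also have "\<dots> = of_bool ((N #> f, N #> h) \<in> ?S)"
      using fin by simp
    also have "(N #> f, N #> h) \<in> ?S \<longleftrightarrow> N #> (f \<otimes> h) = N #> c"
      using normal.rcos_sum[OF D(1) f h] rcosetsI[OF D(3)] f h c by auto
    finally show ?thesis
      using True group_element_coset[OF N m_closed[OF f h] c(1)] coset_normal_coset[OF N c(1)] c(2)
      by (simp add: group_algebra_mult_def)
  qed
qed

lemma group_algebra_add: "a \<in> GA \<Longrightarrow> b \<in> GA \<Longrightarrow> (\<lambda>C. a C + b C) \<in> GA"
  by (auto simp: group_algebra_def sum.distrib)

lemma group_algebra_smult: "a \<in> GA \<Longrightarrow> (\<lambda>C. c * a C) \<in> GA"
  by (auto simp: group_algebra_def sum_distrib_left)

lemma continuous_group_element: "continuous_map T (group_algebra_topology G T) ge"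
proof -
  have "continuous_map T padic_topology (\<lambda>f. ge f C)" for C
  proof (cases "C \<in> open_cosets G T")
    case False
    then have "(\<lambda>f. ge f C) = (\<lambda>_. 0)" by (simp add: group_element_def)
    then show ?thesis by simp
  next
    case True
    then obtain N h where N: "N \<in> open_normals G T" "h \<in> carrier G" "C = N #> h"
      by (rule open_cosetsE)
    have op: "openin T C" "openin T (carrier G - C)" "C \<subseteq> carrier G"
      using openin_coset[OF N(1,2)] closedin_coset[OF N(1,2)] N(3) openin_subset[of T C]
      by (auto simp: closedin_def)
    have eq: "{f \<in> topspace T. padic_res (ge f C) n = c} =
        (if padic_res (1 :: 'l padic_int) n = c then C else {}) \<union>
        (if padic_res (0 :: 'l padic_int) n = c then carrier G - C else {})" for n c
      using True op(3) by (auto simp: group_element_def)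
    then show ?thesis
      unfolding continuous_map_into_padic eq using op by (intro allI openin_Un) simp_all
  qed
  then show ?thesis
    unfolding group_algebra_topology_def continuous_map_in_subtopology
    using group_element_in_algebra by (auto simp: continuous_map_componentwise_UNIV)
qed

text \<open>The preimage of an open coset under a continuous automorphism is again an open coset.\<close>

lemma group_algebra_map_element:
  assumes auto: "\<phi> \<in> top_auto G T" and f: "f \<in> carrier G"
  shows "group_algebra_map G T \<phi> (ge f) = ge (\<phi> f)"
proof
  fix C
  show "group_algebra_map G T \<phi> (ge f) C = ge (\<phi> f) C"
  proof (cases "C \<in> open_cosets G T")
    case False
    then show ?thesis by (simp add: group_algebra_map_def group_element_def)
  next
    case True
    then obtain N c where N: "N \<in> open_normals G T" and c: "c \<in> carrier G" "C = N #> c"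
      by (rule open_cosetsE)
    note D = open_normalsD[OF N]
    have hom: "\<phi> \<in> hom G G" and bij: "bij_betw \<phi> (carrier G) (carrier G)"
      using auto by (auto simp: top_auto_def auto_def Bij_def)
    interpret \<phi>: group_hom G G \<phi>
      using hom by (simp add: group_hom.intro group_hom_axioms_def is_group)
    obtain h where h: "h \<in> carrier G" "c = \<phi> h"
      using bij c(1) by (auto simp: bij_betw_def)
    define M where "M = {u \<in> carrier G. \<phi> u \<in> N}"
    have M: "subgroup M G"
      using D(2) by (intro subgroup.intro) (auto simp: M_def subgroup.m_closed subgroup.m_inv_closed subgroup.one_closed)
    have "M \<lhd> G"
      unfolding normal_inv_iff using M normal.inv_op_closed2[OF D(1)] by (auto simp: M_def)
    moreover have "openin T {u \<in> topspace T. \<phi> u \<in> N}"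
      using auto D(4) homeomorphic_imp_continuous_map
      by (intro openin_continuous_map_preimage[of T T]) (auto simp: top_auto_def)
    ultimately have MN: "M \<in> open_normals G T" by (simp add: open_normals_def M_def)
    have "{u \<in> carrier G. \<phi> u \<in> C} = M #> h"
    proof -
      have "\<phi> u \<in> C \<longleftrightarrow> u \<in> M #> h" if u: "u \<in> carrier G" for u
      proof -
        have "\<phi> u \<in> C \<longleftrightarrow> \<phi> u \<otimes> inv (\<phi> h) \<in> N"
          using subgroup.rcos_module[OF D(2) is_group] c h u by auto
        also have "\<dots> \<longleftrightarrow> u \<otimes> inv h \<in> M"
          using u h by (simp add: M_def)
        also have "\<dots> \<longleftrightarrow> u \<in> M #> h"
          using subgroup.rcos_module[OF M is_group] h u by auto
        finally show ?thesis .
      qed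
      then show ?thesis
        using subgroup.elemrcos_carrier[OF M is_group h(1)] by blast
    qed
    then show ?thesis
      using True open_cosetsI[OF MN h(1)] f
      by (auto simp: group_algebra_map_def group_element_def)
  qed
qed

end

section \<open>The Magnus embedding\<close>

locale magnus_group = pro_l_group G T lt
  for G :: "('a, 'b) monoid_scheme" (structure) and T and lt :: "'l :: prime_card itself" +
  fixes r :: nat and x :: "nat \<Rightarrow> 'a" and \<Theta> :: "('a set \<Rightarrow> 'l padic_int) \<Rightarrow> 'l padic_int ncps"
  assumes gens: "\<And>i. i \<in> {1..r} \<Longrightarrow> x i \<in> carrier G"
    and magnus: "magnus_iso G T r x \<Theta>"
begin

text \<open>The Magnus expansion of a group element.\<close>

definition \<theta> :: "'a \<Rightarrow> 'l padic_int ncps" where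
  "\<theta> f = \<Theta> (ge f)"

text \<open>These turn out to be the coordinates in the abelianization.\<close>

definition eps :: "nat \<Rightarrow> 'a \<Rightarrow> 'l padic_int" where
  "eps i f = nc_coeff (\<theta> f) [i]"

lemma Theta_homeomorphic: "homeomorphic_map (group_algebra_topology G T) (nc_topology r) \<Theta>"
  using magnus by (simp add: magnus_iso_def)

lemma topspace_GA [simp]: "topspace (group_algebra_topology G T) = GA"
  by (simp add: group_algebra_topology_def)

lemma Theta_inj: "inj_on \<Theta> GA"
  using homeomorphic_imp_injective_map[OF Theta_homeomorphic] by simp

lemma Theta_image: "\<Theta> ` GA = nc_space r"
  using homeomorphic_imp_surjective_map[OF Theta_homeomorphic] by simp

lemma Theta_add: "a \<in> GA \<Longrightarrow> b \<in> GA \<Longrightarrow> \<Theta> (\<lambda>C. a C + b C) = \<Theta> a + \<Theta> b"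
  using magnus by (simp add: magnus_iso_def)

lemma Theta_smult: "a \<in> GA \<Longrightarrow> \<Theta> (\<lambda>C. c * a C) = nc_smult c (\<Theta> a)"
  using magnus by (simp add: magnus_iso_def)

lemma theta_mult:
  assumes "f \<in> carrier G" "h \<in> carrier G"
  shows "\<theta> (f \<otimes> h) = \<theta> f * \<theta> h"
  using magnus assms by (simp add: magnus_iso_def \<theta>_def group_element_mult[symmetric] group_element_in_algebra)

lemma theta_one: "\<theta> \<one> = 1"
  using magnus by (simp add: magnus_iso_def \<theta>_def)

lemma theta_gen: "i \<in> {1..r} \<Longrightarrow> \<theta> (x i) = 1 + nc_X i"
  using magnus by (simp add: magnus_iso_def \<theta>_def)

lemma theta_in_space: "f \<in> carrier G \<Longrightarrow> \<theta> f \<in> nc_space r"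
  using Theta_image group_element_in_algebra unfolding \<theta>_def by blast

lemma continuous_theta_coeff: "continuous_map T padic_topology (\<lambda>f. nc_coeff (\<theta> f) w)"
proof -
  have "continuous_map T (nc_topology r) (\<Theta> \<circ> ge)"
    using continuous_group_element homeomorphic_imp_continuous_map[OF Theta_homeomorphic]
    by (rule continuous_map_compose)
  from continuous_map_compose[OF this continuous_map_nc_coeff] show ?thesis
    by (simp add: o_def \<theta>_def)
qed

lemma theta_inj:
  assumes f: "f \<in> carrier G" and h: "h \<in> carrier G" and eq: "\<theta> f = \<theta> h"
  shows "f = h"
proof (rule pnormal_separates[OF f h])
  fix n N assume "(n, N) \<in> pnormals"
  then have N: "N \<in> open_normals G T" by (rule pnormalsD)
  have "ge f = ge h"
    using Theta_inj eq group_element_in_algebra f h by (auto simp: \<theta>_def inj_on_def)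
  from fun_cong[OF this, of "N #> h"] show "N #> f = N #> h"
    using group_element_coset[OF N f h] group_element_coset[OF N h h] by (auto split: if_splits)
qed

text \<open>The generators generate \<open>G\<close> topologically, already as a monoid. Suppose that \<open>K\<close> misses the
  coset \<open>N f\<close>. The elements of the completed group algebra which vanish on all cosets of \<open>N\<close> missing
  \<open>K\<close> form a closed submodule containing all elements of \<open>K\<close>. Since
  \<open>\<theta>(k) X\<^sub>i = \<theta>(k x\<^sub>i) - \<theta>(k)\<close>, the image of this submodule under the Magnus isomorphism contains all
  monomials, so the submodule is the whole algebra. But it does not contain the group element \<open>f\<close>.

  This is the induction principle for the rest of the file: a closed multiplicative condition holds on
  \<open>G\<close> as soon as it holds for the generators.\<close>

lemma closed_submonoid_with_gens:
  assumes K: "closedin T K" "\<one> \<in> K" "\<And>f h. f \<in> K \<Longrightarrow> h \<in> K \<Longrightarrow> f \<otimes> h \<in> K"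
    and xK: "\<And>i. i \<in> {1..r} \<Longrightarrow> x i \<in> K"
  shows "K = carrier G"
proof
  show Kc: "K \<subseteq> carrier G" using closedin_subset[OF K(1)] by simp
  have meets: "\<exists>s\<in>K. s \<in> N #> f" if N: "(n, N) \<in> pnormals" and f: "f \<in> carrier G" for n N f
  proof -
    note D = pnormalsD[OF N]
    define \<C> where "\<C> = {C \<in> rcosets N. C \<inter> K = {}}"
    define A where "A = {a \<in> GA. \<forall>C\<in>\<C>. a C = 0}"
    let ?P = "product_topology (\<lambda>_. padic_topology) UNIV :: ('a set \<Rightarrow> 'l padic_int) topology"
    have closed1: "closedin ?P {a. a C = 0}" for C
    proof -
      have "continuous_map ?P padic_topology (\<lambda>a. a C)"
        by (rule continuous_map_product_projection) simp
      from closedin_continuous_map_preimage[OF this closedin_padic_singleton[of 0]]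
      show ?thesis by simp
    qed
    have "closedin ?P ((\<Inter>C\<in>\<C>. {a. a C = 0}) \<inter> UNIV)"
    proof (cases "\<C> = {}")
      case True
      then show ?thesis using closedin_topspace[of ?P] by simp
    qed (use closed1 in \<open>auto intro!: closedin_Inter\<close>)
    moreover have "A = (\<Inter>C\<in>\<C>. {a. a C = 0}) \<inter> UNIV \<inter> GA" by (auto simp: A_def)
    ultimately have "closedin (group_algebra_topology G T) A"
      unfolding group_algebra_topology_def closedin_subtopology by blast
    then have closed: "closedin (nc_topology r) (\<Theta> ` A)"
      using homeomorphic_imp_closed_map[OF Theta_homeomorphic] by (simp add: closed_map_def)
    have A_GA: "A \<subseteq> GA" by (auto simp: A_def)
    have add: "s + t \<in> \<Theta> ` A" if st: "s \<in> \<Theta> ` A" "t \<in> \<Theta> ` A" for s t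
    proof -
      obtain a b where ab: "a \<in> A" "b \<in> A" "s = \<Theta> a" "t = \<Theta> b" using st by blast
      then have "(\<lambda>C. a C + b C) \<in> A" by (simp add: A_def group_algebra_add)
      moreover have "\<Theta> (\<lambda>C. a C + b C) = s + t"
        unfolding ab(3,4) using ab(1,2) A_GA by (intro Theta_add) blast+
      ultimately show ?thesis by (metis imageI)
    qed
    have smult: "nc_smult c s \<in> \<Theta> ` A" if s: "s \<in> \<Theta> ` A" for c s
    proof -
      obtain a where a: "a \<in> A" "s = \<Theta> a" using s by blast
      then have "(\<lambda>C. c * a C) \<in> A" by (simp add: A_def group_algebra_smult)
      moreover have "\<Theta> (\<lambda>C. c * a C) = nc_smult c s"
        unfolding a(2) using a(1) A_GA by (intro Theta_smult) blast
      ultimately show ?thesis by (metis imageI)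
    qed
    have elem: "\<theta> k \<in> \<Theta> ` A" if "k \<in> K" for k
    proof -
      have "ge k \<in> A"
        unfolding A_def \<C>_def using that Kc group_element_in_algebra by (auto simp: group_element_def)
      then show ?thesis by (simp add: \<theta>_def)
    qed
    have mono: "\<theta> k * nc_mono w \<in> \<Theta> ` A" if "set w \<subseteq> {1..r}" "k \<in> K" for w k
      using that
    proof (induction w arbitrary: k)
      case Nil
      then show ?case using elem by (simp add: nc_mono_Nil)
    next
      case (Cons i w)
      then have i: "i \<in> {1..r}" and k: "k \<in> carrier G" using Kc by auto
      have "\<theta> k * nc_mono (i # w) = \<theta> (k \<otimes> x i) * nc_mono w + nc_smult (- 1) (\<theta> k * nc_mono w)"
        unfolding theta_mult[OF k gens[OF i]] theta_gen[OF i] nc_mono_Cons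
        by (rule nc_eqI) (simp add: distrib_left distrib_right mult.assoc)
      also have "\<dots> \<in> \<Theta> ` A"
        using Cons i K(3) xK by (intro add smult Cons.IH) auto
      finally show ?case .
    qed
    have "\<Theta> ` A = nc_space r"
      using mono[OF _ K(2)] by (intro nc_closed_span_monos closed add smult) (simp_all add: theta_one)
    then have "\<Theta> (ge f) \<in> \<Theta> ` A"
      using theta_in_space[OF f] by (simp add: \<theta>_def)
    then have "ge f \<in> A"
      using Theta_inj A_GA group_element_in_algebra[OF f] by (auto simp: inj_on_def)
    moreover have "ge f (N #> f) = 1"
      using group_element_coset[OF D(1) f f] by simp
    ultimately have "N #> f \<notin> \<C>" by (auto simp: A_def)
    then show ?thesis
      using rcosetsI[OF D(4) f] by (auto simp: \<C>_def)
  qed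
  show "carrier G \<subseteq> K"
  proof
    fix f assume "f \<in> carrier G"
    then have "f \<in> Abstract_Topology.closure_of T K"
      unfolding in_closure_iff[OF Kc] using meets by blast
    then show "f \<in> K" using closure_of_closedin[OF K(1)] by simp
  qed
qed

lemma theta_constant_coeff:
  assumes "f \<in> carrier G"
  shows "nc_coeff (\<theta> f) [] = 1"
proof -
  have "{f \<in> topspace T. nc_coeff (\<theta> f) [] \<in> {1}} = carrier G"
  proof (rule closed_submonoid_with_gens)
    show "closedin T {f \<in> topspace T. nc_coeff (\<theta> f) [] \<in> {1}}"
      by (rule closedin_continuous_map_preimage[OF continuous_theta_coeff closedin_padic_singleton])
  qed (auto simp: theta_one theta_mult nc_coeff_mult_Nil theta_gen gens nc_coeff_one nc_coeff_X)
  then show ?thesis using assms by auto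
qed

lemma eps_mult: "f \<in> carrier G \<Longrightarrow> h \<in> carrier G \<Longrightarrow> eps i (f \<otimes> h) = eps i f + eps i h"
  by (simp add: eps_def theta_mult nc_coeff_mult_single theta_constant_coeff)

lemma eps_one: "eps i \<one> = 0"
  by (simp add: eps_def theta_one nc_coeff_one)

lemma eps_inv: "f \<in> carrier G \<Longrightarrow> eps i (inv f) = - eps i f"
  using eps_mult[of f "inv f" i] by (simp add: eps_one eq_neg_iff_add_eq_0 add.commute)

lemma eps_gen: "j \<in> {1..r} \<Longrightarrow> eps i (x j) = of_bool (i = j)"
  by (simp add: eps_def theta_gen nc_coeff_one nc_coeff_X)

lemma eps_outside: "f \<in> carrier G \<Longrightarrow> i \<notin> {1..r} \<Longrightarrow> eps i f = 0"
  using theta_in_space[of f] by (force simp: eps_def nc_space_def)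

lemma continuous_eps: "continuous_map T padic_topology (eps i)"
  unfolding eps_def by (rule continuous_theta_coeff)

lemma eps_pow: "f \<in> carrier G \<Longrightarrow> eps i (f [^] (n::nat)) = of_nat n * eps i f"
  by (induction n) (auto simp: eps_one eps_mult algebra_simps)

text \<open>The formula is clear for natural exponents and extends to l-adic ones by continuity.\<close>

lemma eps_pro_pow_gen:
  assumes j: "j \<in> {1..r}"
  shows "eps i (pro_pow G T (x j) c) = of_bool (i = j) * c"
proof (rule limitin_Hausdorff_unique[OF _ _ trivial_limit_sequentially Hausdorff_space_padic])
  let ?f = "\<lambda>k. eps i (x j [^] nat (padic_res c k))"
  show "limitin padic_topology ?f (eps i (pro_pow G T (x j) c)) sequentially"
    using continuous_map_limit[OF continuous_eps pro_pow_props(3)[OF gens[OF j]]] by (simp add: o_def)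
  show "limitin padic_topology ?f (of_bool (i = j) * c) sequentially"
    using padic_residues_converge[of c]
    by (cases "i = j") (simp_all add: eps_pow gens[OF j] eps_gen[OF j] del: of_nat_nat)
qed

text \<open>A commutator satisfies \<open>\<theta>([a,b]) - 1 = (uv - vu) \<theta>(a)\<^sup>-\<^sup>1 \<theta>(b)\<^sup>-\<^sup>1\<close> with \<open>u = \<theta>(a) - 1\<close> and
  \<open>v = \<theta>(b) - 1\<close>, so its order exceeds that of \<open>u\<close>. The elements \<open>f\<close> for which \<open>\<theta>(f) - 1\<close> has order
  at least \<open>n\<close> form a closed subgroup, which takes care of the closure in the lower central series.\<close>

lemma theta_lcs:
  assumes "f \<in> pro_lcs G T n" "n \<ge> 1"
  shows "f \<in> carrier G" "\<theta> f - 1 \<in> nc_order_ge n"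
proof -
  define F where "F n = {f \<in> carrier G. \<theta> f - 1 \<in> nc_order_ge n}" for n
  have closed: "closedin T (F n)" for n
  proof -
    let ?S = "\<lambda>w. {f \<in> topspace T. nc_coeff (\<theta> f) w \<in> {nc_coeff 1 w}}"
    have "closedin T (?S w)" for w
      by (rule closedin_continuous_map_preimage[OF continuous_theta_coeff closedin_padic_singleton])
    then have "closedin T (topspace T \<inter> \<Inter> (?S ` {w. length w < n}))"
      using closedin_topspace[of T]
      by (cases "{w :: nat list. length w < n} = {}") (auto intro!: closedin_Int closedin_Inter)
    also have "topspace T \<inter> \<Inter> (?S ` {w. length w < n}) = F n"
      by (auto simp: F_def nc_order_ge_def)
    finally show ?thesis .
  qed
  have sub: "subgroup (F n) G" for n
  proof (rule subgroup.intro)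
    fix f h assume f: "f \<in> F n" and h: "h \<in> F n"
    have "\<theta> (f \<otimes> h) - 1 = (\<theta> f - 1) * \<theta> h + (\<theta> h - 1)"
      using f h by (simp add: F_def theta_mult algebra_simps)
    also have "\<dots> \<in> nc_order_ge n"
      using f h by (intro nc_order_ge_add nc_order_ge_mult_right) (auto simp: F_def)
    finally show "f \<otimes> h \<in> F n" using f h by (simp add: F_def)
  next
    fix f assume f: "f \<in> F n"
    then have "\<theta> f * \<theta> (inv f) = 1"
      by (simp add: F_def theta_mult[symmetric] theta_one)
    then have "\<theta> (inv f) - 1 = 0 - (\<theta> f - 1) * \<theta> (inv f)"
      by (simp add: algebra_simps)
    also have "\<dots> \<in> nc_order_ge n"
      using f by (intro nc_order_ge_diff[OF nc_order_ge_zero nc_order_ge_mult_right]) (simp add: F_def)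
    finally show "inv f \<in> F n" using f by (simp add: F_def)
  qed (auto simp: F_def theta_one nc_order_ge_def)
  have comm: "a \<otimes> b \<otimes> inv a \<otimes> inv b \<in> F (Suc n)" if a: "a \<in> F n" and b: "b \<in> carrier G" for a b n
  proof -
    have ac: "a \<in> carrier G" using a by (simp add: F_def)
    have ia: "\<theta> a * \<theta> (inv a) = 1" and ib: "\<theta> b * \<theta> (inv b) = 1"
      using ac b by (simp_all add: theta_mult[symmetric] theta_one)
    have b1: "\<theta> b - 1 \<in> nc_order_ge 1"
      using theta_constant_coeff[OF b] by (simp add: nc_order_ge_def nc_coeff_one)
    have "\<theta> b * \<theta> a * \<theta> (inv a) * \<theta> (inv b) = 1"
      by (simp add: mult.assoc ia ib)
    then have "\<theta> (a \<otimes> b \<otimes> inv a \<otimes> inv b) - 1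
        = (\<theta> a * \<theta> b - \<theta> b * \<theta> a) * \<theta> (inv a) * \<theta> (inv b)"
      using ac b by (simp add: theta_mult left_diff_distrib)
    also have "\<theta> a * \<theta> b - \<theta> b * \<theta> a = (\<theta> a - 1) * (\<theta> b - 1) - (\<theta> b - 1) * (\<theta> a - 1)"
      by (simp add: algebra_simps)
    also have "\<dots> * \<theta> (inv a) * \<theta> (inv b) \<in> nc_order_ge (Suc n)"
    proof -
      have "\<theta> a - 1 \<in> nc_order_ge n" using a by (simp add: F_def)
      then have "(\<theta> a - 1) * (\<theta> b - 1) - (\<theta> b - 1) * (\<theta> a - 1) \<in> nc_order_ge (Suc n)"
        using nc_order_ge_mult[OF _ b1, of "\<theta> a - 1" n] nc_order_ge_mult[OF b1, of "\<theta> a - 1" n]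
        by (intro nc_order_ge_diff) simp_all
      then show ?thesis by (intro nc_order_ge_mult_right)
    qed
    finally show ?thesis using ac b by (simp add: F_def)
  qed
  have "pro_lcs G T (Suc n) \<subseteq> F (Suc n)" for n
  proof (induction n)
    case 0
    show ?case
      using theta_constant_coeff by (auto simp: F_def nc_order_ge_def nc_coeff_one)
  next
    case (Suc n)
    let ?A = "{a \<otimes> b \<otimes> inv a \<otimes> inv b | a b. a \<in> pro_lcs G T (Suc n) \<and> b \<in> carrier G}"
    have "?A \<subseteq> F (Suc (Suc n))"
      using comm Suc.IH by blast
    then have "generate G ?A \<subseteq> F (Suc (Suc n))"
      using generate_subgroup_incl[OF _ sub] by blast
    then show ?case
      using closure_of_minimal[OF _ closed] by (simp add: closed_subgroup_generated_def)
  qed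
  from this[of "n - 1"] assms show "f \<in> carrier G" "\<theta> f - 1 \<in> nc_order_ge n"
    by (auto simp: F_def)
qed

lemma eps_lcs:
  assumes "f \<in> pro_lcs G T n" "n \<ge> 2"
  shows "eps i f = 0"
proof -
  have "\<theta> f - 1 \<in> nc_order_ge n"
    by (rule theta_lcs(2)[OF assms(1)]) (use assms(2) in simp)
  then have "nc_coeff (\<theta> f - 1) [i] = 0"
    unfolding nc_order_ge_def using assms(2) by simp
  then show ?thesis by (simp add: eps_def nc_coeff_one)
qed

section \<open>The abelianization\<close>

abbreviation (input) "L2 \<equiv> pro_lcs G T 2"

lemma lcs2_normal: "L2 \<lhd> G"
  and lcs2_comm: "a \<in> carrier G \<Longrightarrow> b \<in> carrier G \<Longrightarrow> L2 #> (a \<otimes> b) = L2 #> (b \<otimes> a)"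
  and lcs2_closed: "closedin T L2"
proof -
  let ?A = "{a \<otimes> b \<otimes> inv a \<otimes> inv b | a b. a \<in> carrier G \<and> b \<in> carrier G}"
  have L2: "L2 = Abstract_Topology.closure_of T (generate G ?A)"
    by (simp add: numeral_2_eq_2 closed_subgroup_generated_def)
  have A: "?A \<subseteq> carrier G" by auto
  have sub: "subgroup L2 G"
    unfolding L2 by (rule closure_subgroup[OF generate_is_subgroup[OF A]])
  have "generate G ?A \<subseteq> L2"
    unfolding L2 using generate_incl[OF A] by (intro closure_of_subset) simp
  then have comm: "a \<otimes> b \<otimes> inv a \<otimes> inv b \<in> L2" if "a \<in> carrier G" "b \<in> carrier G" for a b
    using that generate.incl[of _ ?A G] by blast
  show "closedin T L2" unfolding L2 by simp
  show "L2 \<lhd> G"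
    using sub comm subgroup.mem_carrier[OF sub] by (intro commutator_closed_subgroup_normal) auto
  show "L2 #> (a \<otimes> b) = L2 #> (b \<otimes> a)" if a: "a \<in> carrier G" and b: "b \<in> carrier G"
  proof -
    have "(a \<otimes> b) \<otimes> inv (b \<otimes> a) \<in> L2"
      using comm[OF a b] a b by (simp add: inv_mult_group m_assoc)
    then have "a \<otimes> b \<in> L2 #> (b \<otimes> a)"
      using subgroup.rcos_module[OF sub is_group] a b by simp
    then show ?thesis
      using rcos_eq_iff[OF sub] a b by simp
  qed
qed

lemma foldr_mult_closed:
  "(\<And>i. i \<in> set is \<Longrightarrow> f i \<in> carrier G) \<Longrightarrow> foldr (\<lambda>i a. f i \<otimes> a) is \<one> \<in> carrier G"
  by (induction "is") auto

definition gen_prod :: "(nat \<Rightarrow> 'l padic_int) \<Rightarrow> 'a" where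
  "gen_prod c = ordered_prod G r (\<lambda>i. pro_pow G T (x i) (c i))"

lemma foldr_pow_closed:
  assumes "set is \<subseteq> {1..r}"
  shows "foldr (\<lambda>i a. pro_pow G T (x i) (c i :: 'l padic_int) \<otimes> a) is \<one> \<in> carrier G"
  using assms gens pro_pow_props(1) by (intro foldr_mult_closed) blast

lemma gen_prod_closed: "gen_prod c \<in> carrier G"
  unfolding gen_prod_def ordered_prod_def by (rule foldr_pow_closed) auto

lemma eps_gen_prod:
  assumes j: "j \<in> {1..r}"
  shows "eps j (gen_prod c) = c j"
proof -
  have "eps j (foldr (\<lambda>i a. pro_pow G T (x i) (c i) \<otimes> a) is \<one>) = (\<Sum>i\<in>set is. if i = j then c j else 0)"
    if "set is \<subseteq> {1..r}" "distinct is" for "is"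
    using that
  proof (induction "is")
    case (Cons i "is")
    have i: "pro_pow G T (x i) (c i) \<in> carrier G" "i \<in> {1..r}"
      using gens Cons.prems pro_pow_props(1) by auto
    have "foldr (\<lambda>i a. pro_pow G T (x i) (c i) \<otimes> a) is \<one> \<in> carrier G"
      using foldr_pow_closed[of "is" c] Cons.prems by simp
    then show ?case
      using Cons i by (auto simp: eps_mult eps_pro_pow_gen)
  qed (simp add: eps_one)
  from this[of "[1..<Suc r]"] show ?thesis
    using j unfolding gen_prod_def ordered_prod_def by (simp add: atLeastLessThanSuc_atLeastAtMost sum.delta del: upt_Suc)
qed

lemma gen_prod_add_mod_lcs2:
  "L2 #> gen_prod (\<lambda>i. c i + d i) = L2 #> (gen_prod c \<otimes> gen_prod d)"
proof -
  let ?p = "\<lambda>c is. foldr (\<lambda>i a. pro_pow G T (x i) (c i) \<otimes> a) is \<one>"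
  have "L2 #> ?p (\<lambda>i. c i + d i) is = L2 #> (?p c is \<otimes> ?p d is)" if "set is \<subseteq> {1..r}" for "is"
    using that
  proof (induction "is")
    case (Cons i "is")
    have xi: "x i \<in> carrier G" using gens Cons.prems by auto
    have P: "?p e is \<in> carrier G" for e :: "nat \<Rightarrow> 'l padic_int"
      using foldr_pow_closed[of "is" e] Cons.prems by simp
    note Q = pro_pow_props(1)[OF xi]
    let ?c = "pro_pow G T (x i) (c i)" and ?d = "pro_pow G T (x i) (d i)"
    have "L2 #> ?p (\<lambda>i. c i + d i) (i # is) = L2 #> ((?c \<otimes> ?d) \<otimes> ?p (\<lambda>i. c i + d i) is)"
      using pro_pow_add[OF xi] by simp
    also have "\<dots> = L2 #> ((?c \<otimes> ?d) \<otimes> (?p c is \<otimes> ?p d is))"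
      using Cons P Q by (intro rcos_cong_mult[OF lcs2_normal]) auto
    also have "\<dots> = L2 #> (?c \<otimes> ((?d \<otimes> ?p c is) \<otimes> ?p d is))"
      using P Q by (simp add: m_assoc)
    also have "\<dots> = L2 #> (?c \<otimes> ((?p c is \<otimes> ?d) \<otimes> ?p d is))"
      using P Q by (intro rcos_cong_mult[OF lcs2_normal] refl lcs2_comm) auto
    also have "\<dots> = L2 #> (?p c (i # is) \<otimes> ?p d (i # is))"
      using P Q by (simp add: m_assoc)
    finally show ?case .
  qed simp
  from this[of "[1..<Suc r]"] show ?thesis
    unfolding gen_prod_def ordered_prod_def
    by (simp add: atLeastLessThanSuc_atLeastAtMost del: upt_Suc)
qed

lemma gen_prod_gen:
  assumes j: "j \<in> {1..r}"
  shows "gen_prod (\<lambda>i. of_bool (i = j)) = x j"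
proof -
  let ?p = "\<lambda>is. foldr (\<lambda>i a. pro_pow G T (x i) (of_bool (i = j) :: 'l padic_int) \<otimes> a) is \<one>"
  have "?p is = (if j \<in> set is then x j else \<one>)" if "set is \<subseteq> {1..r}" "distinct is" for "is"
    using that
  proof (induction "is")
    case (Cons i "is")
    then show ?case using gens[of i] gens[OF j] by (auto simp: pro_pow_0 pro_pow_1)
  qed simp
  from this[of "[1..<Suc r]"] show ?thesis
    using j unfolding gen_prod_def ordered_prod_def
    by (simp add: atLeastLessThanSuc_atLeastAtMost del: upt_Suc)
qed

lemma continuous_gen_prod:
  assumes "\<And>i. continuous_map Z padic_topology (\<lambda>z. c z i)"
  shows "continuous_map Z T (\<lambda>z. gen_prod (c z))"
proof -
  have "continuous_map Z T (\<lambda>z. foldr (\<lambda>i a. pro_pow G T (x i) (c z i) \<otimes> a) is \<one>)"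
    if "set is \<subseteq> {1..r}" for "is"
    using that
  proof (induction "is")
    case (Cons i "is")
    have "continuous_map Z T (\<lambda>z. pro_pow G T (x i) (c z i))"
      using continuous_map_compose[OF assms continuous_pro_pow[OF gens]] Cons.prems by (auto simp: o_def)
    then show ?case using Cons by (auto intro: continuous_mult)
  qed simp
  from this[of "[1..<Suc r]"] show ?thesis
    unfolding gen_prod_def ordered_prod_def
    by (simp add: atLeastLessThanSuc_atLeastAtMost del: upt_Suc)
qed

text \<open>Both sides are multiplicative and continuous in \<open>f\<close> modulo the closed subgroup \<open>L2\<close>, and they
  agree on the generators.\<close>

lemma gen_prod_eps_mod_lcs2:
  assumes f: "f \<in> carrier G"
  shows "L2 #> f = L2 #> gen_prod (\<lambda>i. eps i f)"
proof -
  note sub = normal_imp_subgroup[OF lcs2_normal]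
  let ?P = "\<lambda>f. gen_prod (\<lambda>i. eps i f)"
  let ?K = "{f \<in> topspace T. f \<otimes> inv (?P f) \<in> L2}"
  have K: "f \<in> ?K \<longleftrightarrow> f \<in> carrier G \<and> L2 #> f = L2 #> ?P f" for f
    unfolding mem_Collect_eq topspace_T
    using subgroup.rcos_module[OF sub is_group gen_prod_closed] rcos_eq_iff[OF sub _ gen_prod_closed] by metis
  have "?K = carrier G"
  proof (rule closed_submonoid_with_gens)
    have "continuous_map T T (\<lambda>f. f \<otimes> inv (?P f))"
      by (intro continuous_mult continuous_inv continuous_gen_prod continuous_eps) simp
    then show "closedin T ?K"
      using lcs2_closed by (rule closedin_continuous_map_preimage)
    have "?P \<one> = \<one>"
    proof -
      have "foldr (\<lambda>i a. pro_pow G T (x i) (0 :: 'l padic_int) \<otimes> a) is \<one> = \<one>" if "set is \<subseteq> {1..r}" for "is"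
        using that gens by (induction "is") (auto simp: pro_pow_0)
      from this[of "[1..<Suc r]"] show ?thesis
        by (simp add: gen_prod_def ordered_prod_def eps_one atLeastLessThanSuc_atLeastAtMost del: upt_Suc)
    qed
    then show "\<one> \<in> ?K" unfolding K by simp
  next
    fix f h assume fh: "f \<in> ?K" "h \<in> ?K"
    then have c: "f \<in> carrier G" "h \<in> carrier G" by auto
    have "L2 #> (f \<otimes> h) = L2 #> (?P f \<otimes> ?P h)"
      using fh gen_prod_closed unfolding K by (intro rcos_cong_mult[OF lcs2_normal]) auto
    also have "\<dots> = L2 #> ?P (f \<otimes> h)"
      using c by (simp add: eps_mult gen_prod_add_mod_lcs2)
    finally show "f \<otimes> h \<in> ?K" unfolding K using c by simp
  next
    fix i assume i: "i \<in> {1..r}"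
    then show "x i \<in> ?K" unfolding K using gens gen_prod_gen[OF i] by (simp add: eps_gen)
  qed
  then show ?thesis using K f by blast
qed

text \<open>This identifies the coordinates in the abelianization, which are defined by the left-hand side,
  with the linear coefficients of the Magnus expansion.\<close>

lemma coordinates_iff:
  assumes f: "f \<in> carrier G"
  shows "(\<forall>i. i \<notin> {1..r} \<longrightarrow> c i = 0) \<and> f \<in> gen_prod c <# L2 \<longleftrightarrow> c = (\<lambda>i. eps i f)"
proof -
  have coset: "f \<in> gen_prod c <# L2 \<longleftrightarrow> L2 #> f = L2 #> gen_prod c" for c
  proof -
    have "gen_prod c <# L2 = L2 #> gen_prod c"
      using normal.coset_eq[OF lcs2_normal] gen_prod_closed by metis
    then show ?thesis
      using rcos_eq_iff[OF normal_imp_subgroup[OF lcs2_normal] f gen_prod_closed] by simp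
  qed
  show ?thesis
  proof
    assume c: "(\<forall>i. i \<notin> {1..r} \<longrightarrow> c i = 0) \<and> f \<in> gen_prod c <# L2"
    then obtain k where k: "k \<in> L2" "f = gen_prod c \<otimes> k" by (auto simp: l_coset_def)
    have *: "eps i f = c i" if "i \<in> {1..r}" for i
      using k eps_lcs[OF k(1), of i] theta_lcs(1)[OF k(1)] eps_gen_prod[OF that, of c]
      by (simp add: eps_mult gen_prod_closed)
    show "c = (\<lambda>i. eps i f)"
    proof
      fix i show "c i = eps i f"
        using *[of i] c eps_outside[OF f, of i] by (cases "i \<in> {1..r}") simp_all
    qed
  next
    assume c: "c = (\<lambda>i. eps i f)"
    show "(\<forall>i. i \<notin> {1..r} \<longrightarrow> c i = 0) \<and> f \<in> gen_prod c <# L2"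
    proof (intro conjI allI impI)
      show "f \<in> gen_prod c <# L2"
        unfolding coset unfolding c by (rule gen_prod_eps_mod_lcs2[OF f])
      show "c i = 0" if "i \<notin> {1..r}" for i
        unfolding c by (rule eps_outside[OF f that])
    qed
  qed
qed

section \<open>Centralizers of the generators\<close>

text \<open>The words in the letter \<open>i\<close> alone see the retraction of \<open>G\<close> onto the closed subgroup generated by
  \<open>x\<^sub>i\<close>, under which the other generators become trivial and \<open>f\<close> becomes a power of \<open>x\<^sub>i\<close>. The
  equation is multiplicative in \<open>f\<close>, since all subwords of \<open>w\<close> are again words in the letter \<open>i\<close>.\<close>

lemma theta_coeff_of_single_letter:
  assumes i: "i \<in> {1..r}" and f: "f \<in> carrier G" and w: "set w \<subseteq> {i}"
  shows "nc_coeff (\<theta> f) w = nc_coeff (\<theta> (pro_pow G T (x i) (eps i f))) w"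
proof -
  note xi = gens[OF i]
  let ?p = "\<lambda>f. pro_pow G T (x i) (eps i f)"
  let ?S = "\<lambda>w. {f \<in> topspace T. nc_coeff (\<theta> f) w = nc_coeff (\<theta> (?p f)) w}"
  have closed: "closedin T (?S w)" for w
  proof (rule closedin_continuous_maps_eq[OF Hausdorff_space_padic continuous_theta_coeff])
    have "continuous_map T T (\<lambda>f. ?p f)"
      using continuous_map_compose[OF continuous_eps continuous_pro_pow[OF xi]] by (simp add: o_def)
    from continuous_map_compose[OF this continuous_theta_coeff]
    show "continuous_map T padic_topology (\<lambda>f. nc_coeff (\<theta> (?p f)) w)" by (simp add: o_def)
  qed
  have pc: "?p f \<in> carrier G" for f using pro_pow_props(1)[OF xi] .
  have "\<Inter> (?S ` {w. set w \<subseteq> {i}}) = carrier G"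
  proof (rule closed_submonoid_with_gens)
    show "closedin T (\<Inter> (?S ` {w. set w \<subseteq> {i}}))"
    proof (rule closedin_Inter)
      have "[] \<in> {w. set w \<subseteq> {i}}" by simp
      then show "?S ` {w. set w \<subseteq> {i}} \<noteq> {}" by blast
    qed (use closed in blast)
    show "\<one> \<in> \<Inter> (?S ` {w. set w \<subseteq> {i}})"
      by (auto simp: eps_one pro_pow_0 xi)
  next
    fix f h assume f: "f \<in> \<Inter> (?S ` {w. set w \<subseteq> {i}})" and h: "h \<in> \<Inter> (?S ` {w. set w \<subseteq> {i}})"
    have c: "f \<in> carrier G" "h \<in> carrier G"
      using INT_D[OF f, of "[]"] INT_D[OF h, of "[]"] by auto
    have "nc_coeff (\<theta> (f \<otimes> h)) w = nc_coeff (\<theta> (?p (f \<otimes> h))) w" if w: "set w \<subseteq> {i}" for w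
    proof -
      have "?p (f \<otimes> h) = ?p f \<otimes> ?p h"
        using c by (simp add: eps_mult pro_pow_add xi)
      moreover have "nc_coeff (\<theta> f) (take k w) = nc_coeff (\<theta> (?p f)) (take k w)"
        "nc_coeff (\<theta> h) (drop k w) = nc_coeff (\<theta> (?p h)) (drop k w)" for k
        using INT_D[OF f, of "take k w"] INT_D[OF h, of "drop k w"] w
          set_take_subset[of k w] set_drop_subset[of k w] by auto
      ultimately show ?thesis
        using c pc by (simp add: theta_mult nc_coeff_mult)
    qed
    then show "f \<otimes> h \<in> \<Inter> (?S ` {w. set w \<subseteq> {i}})" using c by auto
  next
    fix j assume j: "j \<in> {1..r}"
    have "nc_coeff (\<theta> (x j)) w = nc_coeff (\<theta> (?p (x j))) w" if "set w \<subseteq> {i}" for w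
      using that xi j by (cases "i = j") (auto simp: eps_gen pro_pow_1 pro_pow_0 theta_gen theta_one nc_coeff_X)
    then show "x j \<in> \<Inter> (?S ` {w. set w \<subseteq> {i}})" using gens[OF j] by auto
  qed
  then show ?thesis using f w by blast
qed

text \<open>Both sides commute with \<open>x\<^sub>i\<close>, so their Magnus expansions are power series in \<open>X\<^sub>i\<close>, and these
  agree by the previous lemma. The Magnus expansion is injective.\<close>

lemma centralizer_gen:
  assumes i: "i \<in> {1..r}" and f: "f \<in> carrier G" and comm: "f \<otimes> x i = x i \<otimes> f"
  shows "f = pro_pow G T (x i) (eps i f)"
proof (rule theta_inj[OF f pro_pow_props(1)[OF gens[OF i]]])
  note xi = gens[OF i]
  have supp: "set w \<subseteq> {i}" if h: "h \<in> carrier G" "h \<otimes> x i = x i \<otimes> h" and w: "nc_coeff (\<theta> h) w \<noteq> 0" for h w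
  proof (rule commutes_X_support[OF _ w])
    have "\<theta> h * \<theta> (x i) = \<theta> (x i) * \<theta> h"
      using h xi by (simp add: theta_mult[symmetric])
    then show "nc_X i * \<theta> h = \<theta> h * nc_X i"
      by (simp add: theta_gen[OF i] algebra_simps)
  qed
  have pcomm: "pro_pow G T (x i) c \<otimes> x i = x i \<otimes> pro_pow G T (x i) c" for c :: "'l padic_int"
    using pro_pow_add[OF xi, of c 1] pro_pow_add[OF xi, of 1 c] by (simp add: pro_pow_1[OF xi] add.commute)
  show "\<theta> f = \<theta> (pro_pow G T (x i) (eps i f))"
  proof (rule nc_eqI)
    fix w
    show "nc_coeff (\<theta> f) w = nc_coeff (\<theta> (pro_pow G T (x i) (eps i f))) w"
      using supp[OF f comm, of w] supp[OF pro_pow_props(1)[OF xi] pcomm, of "eps i f" w]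
        theta_coeff_of_single_letter[OF i f, of w] by metis
  qed
qed

text \<open>The quotient of two conjugators centralizes \<open>x\<^sub>i\<close>, so it is a power of \<open>x\<^sub>i\<close>, with exponent 0 by the
  normalization. This makes the longitudes well-defined.\<close>

lemma conjugator_unique:
  assumes i: "i \<in> {1..r}" and y: "y \<in> carrier G" "eps i y = 0" and z: "z \<in> carrier G" "eps i z = 0"
    and eq: "y \<otimes> x i \<otimes> inv y = z \<otimes> x i \<otimes> inv z"
  shows "y = z"
proof -
  note xi = gens[OF i]
  let ?u = "inv z \<otimes> y"
  have "?u \<otimes> x i = inv z \<otimes> (y \<otimes> x i \<otimes> inv y) \<otimes> y"
    using y z xi by (simp add: m_assoc)
  also have "\<dots> = x i \<otimes> ?u"
    unfolding eq using y z xi by (simp add: m_assoc[symmetric])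
  finally have "?u = pro_pow G T (x i) (eps i ?u)"
    using y z by (intro centralizer_gen[OF i]) auto
  also have "\<dots> = \<one>"
    using y z by (simp add: eps_mult eps_inv pro_pow_0 xi)
  finally show ?thesis
    using y z by (metis inv_closed inv_equality inv_inv)
qed

text \<open>Multiplying a conjugator by a power of \<open>x\<^sub>i\<close> does not change the conjugate but shifts the
  coefficient of \<open>X\<^sub>i\<close>.\<close>

lemma conjugator_normalize:
  assumes i: "i \<in> {1..r}" and y: "y \<in> carrier G"
  shows "\<exists>z\<in>carrier G. eps i z = 0 \<and> z \<otimes> x i \<otimes> inv z = y \<otimes> x i \<otimes> inv y"
proof (intro bexI conjI)
  note xi = gens[OF i]
  let ?p = "pro_pow G T (x i) (- eps i y)"
  have p: "?p \<in> carrier G" by (rule pro_pow_props(1)[OF xi])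
  show "eps i (y \<otimes> ?p) = 0"
    using y p by (simp add: eps_mult eps_pro_pow_gen[OF i])
  have "?p \<otimes> x i = x i \<otimes> ?p"
    using pro_pow_add[OF xi, of "- eps i y" 1] pro_pow_add[OF xi, of 1 "- eps i y"]
    by (simp add: pro_pow_1[OF xi] add.commute)
  then have "?p \<otimes> x i \<otimes> inv ?p = x i"
    using p xi by (simp add: m_assoc)
  then show "y \<otimes> ?p \<otimes> x i \<otimes> inv (y \<otimes> ?p) = y \<otimes> x i \<otimes> inv y"
    using y p xi by (simp add: inv_mult_group m_assoc[symmetric]) (simp add: m_assoc)
  show "y \<otimes> ?p \<in> carrier G" using y p by simp
qed

text \<open>The difference \<open>d = \<theta>(y x\<^sub>i y\<^sup>-\<^sup>1) - \<theta>(x\<^sub>i)\<close> satisfies \<open>d \<theta>(y) = \<theta>(y) X\<^sub>i - X\<^sub>i \<theta>(y)\<close> exactly, and by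
  assumption it has order at least \<open>m + 1\<close>. In degree \<open>m + 1\<close> the factor \<open>\<theta>(y)\<close>, with constant term 1,
  can be dropped.\<close>

lemma theta_conjugate_leading:
  assumes i: "i \<in> {1..r}" and y: "y \<in> carrier G"
    and deep: "(y \<otimes> x i \<otimes> inv y) \<otimes> inv (x i) \<in> pro_lcs G T (m + 1)" and w: "length w = m + 1"
  shows "nc_coeff (\<theta> (y \<otimes> x i \<otimes> inv y) - \<theta> (x i)) w = nc_coeff (\<theta> y * nc_X i - nc_X i * \<theta> y) w"
proof -
  note xi = gens[OF i]
  let ?c = "y \<otimes> x i \<otimes> inv y"
  have c: "?c \<in> carrier G" using y xi by simp
  have 1: "\<theta> ?c - \<theta> (x i) \<in> nc_order_ge (m + 1)"
  proof -
    have "\<theta> ?c = \<theta> (?c \<otimes> inv (x i)) * \<theta> (x i)"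
      using c xi by (simp add: theta_mult[symmetric] m_assoc)
    then have "\<theta> ?c - \<theta> (x i) = (\<theta> (?c \<otimes> inv (x i)) - 1) * \<theta> (x i)"
      by (simp add: algebra_simps)
    then show ?thesis
      using theta_lcs(2)[OF deep] by (simp add: nc_order_ge_mult_right)
  qed
  have "\<theta> ?c * \<theta> y = \<theta> y * \<theta> (x i)"
    using y xi c by (simp add: theta_mult[symmetric] m_assoc)
  then have "(\<theta> ?c - \<theta> (x i)) * \<theta> y = \<theta> y * nc_X i - nc_X i * \<theta> y"
    by (simp add: theta_gen[OF i] algebra_simps)
  then show ?thesis
    using nc_coeff_mult_leading[OF 1 w theta_constant_coeff[OF y]] by simp
qed

end

section \<open>The Ihara representation\<close>

locale ihara =
  fixes D :: "('a, 'l :: prime_card) ihara_data"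
  assumes setting: "ihara_setting D"
begin

sublocale magnus_group "Fr D" "Frtop D" "TYPE('l)" "rk D" "gen D" "Magnus D"
proof -
  have pro: "pro_group CARD('l) (Fr D) (Frtop D)"
    using setting by (simp add: ihara_setting_def free_pro_group_def)
  then interpret group "Fr D" by (simp add: pro_group_def)
  show "magnus_group (Fr D) (Frtop D) (rk D) (gen D) (Magnus D)"
    by unfold_locales (use pro setting in \<open>auto simp: ihara_setting_def free_pro_group_def\<close>)
qed

lemma ab_coord_eq:
  assumes "f \<in> carrier (Fr D)"
  shows "ab_coord D f = (\<lambda>i. eps i f)"
  unfolding ab_coord_def coordinates_iff[OF assms, unfolded gen_prod_def] by (rule the_eq_trivial)

lemma nc_coeff_ab_class:
  assumes "f \<in> carrier (Fr D)"
  shows "nc_coeff (ab_class D f) w = (if length w = 1 then eps (hd w) f else 0)"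
proof (cases "length w = 1")
  case True
  then obtain j where w: "w = [j]" by (auto simp: length_Suc_conv)
  have "nc_coeff (ab_class D f) w = (\<Sum>i\<in>{1..rk D}. if i = j then eps j f else 0)"
    unfolding ab_class_def nc_coeff_sum
    by (rule sum.cong) (auto simp: ab_coord_eq[OF assms] nc_coeff_X w)
  also have "\<dots> = eps j f"
    using eps_outside[OF assms, of j] by (auto simp: sum.delta)
  finally show ?thesis by (simp add: w)
next
  case False
  then show ?thesis
    unfolding ab_class_def nc_coeff_sum by (auto simp: nc_coeff_X intro!: sum.neutral)
qed

lemma ab_class_surj:
  assumes h: "h \<in> nc_H (rk D)"
  obtains f where "f \<in> carrier (Fr D)" "ab_class D f = h"
proof
  let ?f = "gen_prod (\<lambda>i. nc_coeff h [i])"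
  show "?f \<in> carrier (Fr D)" by (rule gen_prod_closed)
  show "ab_class D ?f = h"
  proof (rule nc_eqI)
    fix w
    have h0: "nc_coeff h w = 0" if "w \<notin> words (rk D) 1" using h that by (auto simp: nc_H_def)
    show "nc_coeff (ab_class D ?f) w = nc_coeff h w"
    proof (cases "w \<in> words (rk D) 1")
      case True
      then obtain j where "w = [j]" "j \<in> {1..rk D}" by (auto simp: words_def length_Suc_conv)
      then show ?thesis
        using nc_coeff_ab_class[OF gen_prod_closed] eps_gen_prod by simp
    next
      case False
      show ?thesis
      proof (cases "length w = 1")
        case True
        then obtain j where w: "w = [j]" by (auto simp: length_Suc_conv)
        then have "j \<notin> {1..rk D}" using False by (auto simp: words_def)
        then show ?thesis
          using nc_coeff_ab_class[OF gen_prod_closed] eps_outside[OF gen_prod_closed] h0[OF False] w by simp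
      qed (use h0[OF False] nc_coeff_ab_class[OF gen_prod_closed] in simp)
    qed
  qed
qed

lemma X_in_H: "i \<in> {1..rk D} \<Longrightarrow> (nc_X i :: 'l padic_int ncps) \<in> nc_H (rk D)"
  by (auto simp: nc_H_def nc_coeff_X words_def)

context
  fixes g m
  assumes m: "m \<ge> 1" and g: "g \<in> Gal_filtration D m"
begin

lemma Ih_in_P: "Ih D g \<in> ihara_P (Fr D) (Frtop D) (rk D) (gen D) (cyclotomic_char g :: 'l padic_int)"
  using setting g by (simp add: ihara_setting_def Gal_filtration_def)

lemma Ih_top_auto: "Ih D g \<in> top_auto (Fr D) (Frtop D)"
  using Ih_in_P by (simp add: ihara_P_def)

lemma Ih_closed: "f \<in> carrier (Fr D) \<Longrightarrow> Ih D g f \<in> carrier (Fr D)"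
  using Ih_top_auto by (auto simp: top_auto_def auto_def hom_def)

lemma Ih_one: "Ih D g \<one>\<^bsub>Fr D\<^esub> = \<one>\<^bsub>Fr D\<^esub>"
  using Ih_top_auto hom_one[OF _ is_group is_group] by (auto simp: top_auto_def auto_def)

lemma Ih_deep: "f \<in> carrier (Fr D) \<Longrightarrow>
    Ih D g f \<otimes>\<^bsub>Fr D\<^esub> inv\<^bsub>Fr D\<^esub> f \<in> pro_lcs (Fr D) (Frtop D) (m + 1)"
  using g by (simp add: Gal_filtration_def)

lemma eps_Ih:
  assumes f: "f \<in> carrier (Fr D)"
  shows "eps i (Ih D g f) = eps i f"
proof -
  have "eps i (Ih D g f \<otimes>\<^bsub>Fr D\<^esub> inv\<^bsub>Fr D\<^esub> f) = 0"
    using m by (intro eps_lcs[OF Ih_deep[OF f]]) simp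
  then show ?thesis using f Ih_closed[OF f] by (simp add: eps_mult eps_inv)
qed

text \<open>So the correction by the action on \<open>H\<close> in the definition of the Johnson map is trivial.\<close>

lemma ab_map_Ih:
  assumes h: "h \<in> nc_H (rk D)"
  shows "ab_map D (Ih D g) h = h"
proof -
  have same: "ab_class D (Ih D g f) = ab_class D f" if "f \<in> carrier (Fr D)" for f
    by (rule nc_eqI) (simp add: nc_coeff_ab_class that Ih_closed eps_Ih)
  obtain f where "f \<in> carrier (Fr D)" "ab_class D f = h" using ab_class_surj[OF h] .
  then show ?thesis
    unfolding ab_map_def using same by (intro the_equality) auto
qed

lemma Ih_conjugate:
  assumes i: "i \<in> {1..rk D}"
  shows "\<exists>y\<in>carrier (Fr D). Ih D g (gen D i) =
    y \<otimes>\<^bsub>Fr D\<^esub> pro_pow (Fr D) (Frtop D) (gen D i) (cyclotomic_char g :: 'l padic_int) \<otimes>\<^bsub>Fr D\<^esub> inv\<^bsub>Fr D\<^esub> y"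
proof (cases "i \<in> {1..rk D - 1}")
  case True
  then show ?thesis using Ih_in_P by (simp add: ihara_P_def)
next
  case False
  then have "i = rk D" using i by auto
  moreover have "closed_subgroup_generated (Fr D) (Frtop D) A \<subseteq> carrier (Fr D)" for A
    using closure_of_subset_topspace[of "Frtop D"] by (simp add: closed_subgroup_generated_def)
  ultimately show ?thesis using Ih_in_P unfolding ihara_P_def by blast
qed

text \<open>The multiplier can be read off on the abelianization, where \<open>g\<close> acts trivially because
  \<open>m \<ge> 1\<close>.\<close>

lemma cyclotomic_char_one: "(cyclotomic_char g :: 'l padic_int) = 1"
proof -
  obtain i where i: "i \<in> {1..rk D}" using setting by (force simp: ihara_setting_def)
  obtain y where y: "y \<in> carrier (Fr D)" "Ih D g (gen D i) =
      y \<otimes>\<^bsub>Fr D\<^esub> pro_pow (Fr D) (Frtop D) (gen D i) (cyclotomic_char g :: 'l padic_int) \<otimes>\<^bsub>Fr D\<^esub> inv\<^bsub>Fr D\<^esub> y"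
    using Ih_conjugate[OF i] by blast
  have "1 = eps i (Ih D g (gen D i))"
    using eps_Ih[OF gens[OF i]] eps_gen[OF i] by simp
  also have "\<dots> = cyclotomic_char g"
    unfolding y(2) using y(1) pro_pow_props(1)[OF gens[OF i]]
    by (simp add: eps_mult eps_inv eps_pro_pow_gen[OF i])
  finally show ?thesis by simp
qed

text \<open>Existence of the longitude comes from the definition of \<open>P(F)\<close>, uniqueness from the centralizer of
  \<open>x\<^sub>i\<close>; the exponent is 1 on the filtration step.\<close>

lemma longitude_props:
  assumes i: "i \<in> {1..rk D}"
  shows "longitude D g i \<in> carrier (Fr D)"
    and "Ih D g (gen D i) = longitude D g i \<otimes>\<^bsub>Fr D\<^esub> gen D i \<otimes>\<^bsub>Fr D\<^esub> inv\<^bsub>Fr D\<^esub> longitude D g i"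
proof -
  let ?Q = "\<lambda>y. y \<in> carrier (Fr D) \<and>
     Ih D g (gen D i) = y \<otimes>\<^bsub>Fr D\<^esub>
       pro_pow (Fr D) (Frtop D) (gen D i) (cyclotomic_char g :: 'l padic_int) \<otimes>\<^bsub>Fr D\<^esub> inv\<^bsub>Fr D\<^esub> y \<and>
     ab_coord D y i = 0"
  have Q: "?Q y \<longleftrightarrow> y \<in> carrier (Fr D) \<and>
      Ih D g (gen D i) = y \<otimes>\<^bsub>Fr D\<^esub> gen D i \<otimes>\<^bsub>Fr D\<^esub> inv\<^bsub>Fr D\<^esub> y \<and> eps i y = 0" for y
    using cyclotomic_char_one pro_pow_1[OF gens[OF i]] ab_coord_eq[of y] by auto
  obtain y where "y \<in> carrier (Fr D)" "Ih D g (gen D i) = y \<otimes>\<^bsub>Fr D\<^esub> gen D i \<otimes>\<^bsub>Fr D\<^esub> inv\<^bsub>Fr D\<^esub> y"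
    using Ih_conjugate[OF i] by (auto simp: cyclotomic_char_one pro_pow_1[OF gens[OF i]])
  then obtain z where z: "z \<in> carrier (Fr D)" "eps i z = 0"
      "Ih D g (gen D i) = z \<otimes>\<^bsub>Fr D\<^esub> gen D i \<otimes>\<^bsub>Fr D\<^esub> inv\<^bsub>Fr D\<^esub> z"
    using conjugator_normalize[OF i, of y] by auto
  have "\<exists>!y. ?Q y"
  proof (rule ex1I)
    show "?Q z" unfolding Q using z by blast
    fix y assume "?Q y"
    then have y: "y \<in> carrier (Fr D)" "eps i y = 0"
        "Ih D g (gen D i) = y \<otimes>\<^bsub>Fr D\<^esub> gen D i \<otimes>\<^bsub>Fr D\<^esub> inv\<^bsub>Fr D\<^esub> y"
      unfolding Q by blast+
    show "y = z"
      by (rule conjugator_unique[OF i y(1,2) z(1,2)]) (simp only: y(3)[symmetric] z(3)[symmetric])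
  qed
  then have "?Q (longitude D g i)" unfolding longitude_def by (rule theI')
  then show "longitude D g i \<in> carrier (Fr D)"
    "Ih D g (gen D i) = longitude D g i \<otimes>\<^bsub>Fr D\<^esub> gen D i \<otimes>\<^bsub>Fr D\<^esub> inv\<^bsub>Fr D\<^esub> longitude D g i"
    unfolding Q by blast+
qed

text \<open>\<open>X\<^sub>i\<close> is the image of \<open>x\<^sub>i - 1\<close>, on which the linear extension of the automorphism is explicit.\<close>

lemma Ih_star_X:
  assumes i: "i \<in> {1..rk D}"
  shows "Ih_star D g (nc_X i) = \<theta> (Ih D g (gen D i)) - 1"
proof -
  let ?diff = "\<lambda>f C. ge f C + (- 1) * ge \<one>\<^bsub>Fr D\<^esub> C"
  have GA: "?diff f \<in> group_algebra (Fr D) (Frtop D)" and Th: "Magnus D (?diff f) = \<theta> f - 1"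
    if f: "f \<in> carrier (Fr D)" for f
  proof -
    note e = group_element_in_algebra[OF f] group_element_in_algebra[OF one_closed]
    note n = group_algebra_smult[OF e(2), of "- 1"]
    show "?diff f \<in> group_algebra (Fr D) (Frtop D)"
      by (rule group_algebra_add[OF e(1) n])
    have "Magnus D (?diff f) = \<theta> f + nc_smult (- 1) (\<theta> \<one>\<^bsub>Fr D\<^esub>)"
      unfolding Theta_add[OF e(1) n] Theta_smult[OF e(2)] \<theta>_def ..
    also have "\<dots> = \<theta> f - 1"
      by (rule nc_eqI) (simp add: theta_one)
    finally show "Magnus D (?diff f) = \<theta> f - 1" .
  qed
  note xi = gens[OF i]
  have "Magnus D (?diff (gen D i)) = nc_X i"
    using Th[OF xi] theta_gen[OF i] by simp
  then have inv: "inv_into (group_algebra (Fr D) (Frtop D)) (Magnus D) (nc_X i) = ?diff (gen D i)"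
    using inv_into_f_f[OF Theta_inj GA[OF xi]] by simp
  have "group_algebra_map (Fr D) (Frtop D) (Ih D g) (?diff (gen D i)) =
      (\<lambda>C. group_algebra_map (Fr D) (Frtop D) (Ih D g) (ge (gen D i)) C
        + (- 1) * group_algebra_map (Fr D) (Frtop D) (Ih D g) (ge \<one>\<^bsub>Fr D\<^esub>) C)"
    by (auto simp: group_algebra_map_def fun_eq_iff)
  also have "\<dots> = ?diff (Ih D g (gen D i))"
    using group_algebra_map_element[OF Ih_top_auto] xi Ih_one by simp
  finally show ?thesis
    unfolding Ih_star_def inv using Th[OF Ih_closed[OF xi]] by simp
qed

lemma johnson_X:
  assumes i: "i \<in> {1..rk D}"
  shows "johnson D g (nc_X i) = \<theta> (Ih D g (gen D i)) - \<theta> (gen D i)"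
proof -
  let ?X = "nc_X i :: 'l padic_int ncps"
  have "inj_on (ab_map D (Ih D g)) (nc_H (rk D))"
    by (rule inj_onI) (simp add: ab_map_Ih)
  from inv_into_f_f[OF this X_in_H[OF i]]
  have "inv_into (nc_H (rk D)) (ab_map D (Ih D g)) ?X = ?X"
    by (simp only: ab_map_Ih[OF X_in_H[OF i]])
  then show ?thesis
    using X_in_H[OF i] Ih_star_X[OF i] theta_gen[OF i] by (simp add: johnson_def algebra_simps)
qed

text \<open>\<open>X\<^sub>i \<theta>(y)\<close> sees the words beginning with \<open>i\<close> and \<open>\<theta>(y) X\<^sub>i\<close> those ending in \<open>i\<close>; this is the origin of
  the two cases in the coefficient \<open>\<mu>(J)\<close>.\<close>

lemma johnson_coeff:
  assumes i: "i \<in> {1..rk D}" and w: "length w = m + 1"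
  defines "y \<equiv> longitude D g i"
  shows "nc_coeff (johnson D g (nc_X i)) w =
    (if last w = i then nc_coeff (\<theta> y) (butlast w) else 0) - (if hd w = i then nc_coeff (\<theta> y) (tl w) else 0)"
proof -
  note y = longitude_props[OF i, folded y_def]
  have "nc_coeff (johnson D g (nc_X i)) w = nc_coeff (\<theta> y * nc_X i - nc_X i * \<theta> y) w"
    unfolding johnson_X[OF i] y(2)
    using Ih_deep[OF gens[OF i]] w unfolding y(2) by (rule theta_conjugate_leading[OF i y(1)])
  also have "w \<noteq> []" using w by auto
  then have "nc_coeff (\<theta> y * nc_X i - nc_X i * \<theta> y) w =
      (if last w = i then nc_coeff (\<theta> y) (butlast w) else 0) - (if hd w = i then nc_coeff (\<theta> y) (tl w) else 0)"
    by (simp add: nc_coeff_X_mult nc_coeff_mult_X)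
  finally show ?thesis .
qed

lemma milnor_eq: "length w \<ge> 2 \<Longrightarrow> milnor D g w = nc_coeff (\<theta> (longitude D g (last w))) (butlast w)"
  by (simp add: milnor_def magnus_coeff_def \<theta>_def)

lemma johnson_coeff_mu:
  assumes i: "i \<in> {1..rk D}" and w: "length w = m + 1"
  shows "nc_coeff (johnson D g (nc_X i)) w = - mu_coeff D g i w"
proof -
  have len: "length w \<ge> 2" using w m by simp
  then have ne: "w \<noteq> []" by auto
  then have rot: "last (rotate1 w) = hd w" "butlast (rotate1 w) = tl w"
    by (cases w; simp)+
  show ?thesis
    unfolding johnson_coeff[OF i w] mu_coeff_def
    using milnor_eq[of w] milnor_eq[of "rotate1 w"] len by (auto simp: rot)
qed

lemma johnson_coeff_outside:
  assumes i: "i \<in> {1..rk D}" and w: "\<not> set w \<subseteq> {1..rk D}"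
  shows "nc_coeff (johnson D g (nc_X i)) w = 0"
proof -
  have "nc_coeff (\<theta> f) w = 0" if "f \<in> carrier (Fr D)" for f
    using theta_in_space[OF that] w unfolding nc_space_def by blast
  then show ?thesis
    unfolding johnson_X[OF i] using gens[OF i] Ih_closed by simp
qed

lemma johnson_hom_X:
  assumes i: "i \<in> {1..rk D}"
  shows "johnson_hom D m g (nc_X i) =
           - (\<Sum>J \<in> words (rk D) (m + 1). nc_smult (mu_coeff D g i J) (nc_mono J))"
proof (rule nc_eqI)
  fix w
  have "nc_coeff (johnson_hom D m g (nc_X i)) w =
      (if length w = m + 1 then nc_coeff (johnson D g (nc_X i)) w else 0)"
    using g X_in_H[OF i]
    by (simp add: johnson_hom_def johnson_part_def nc_degree_part_def Abs_ncps_inverse)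
  also have "\<dots> = - (if w \<in> words (rk D) (m + 1) then mu_coeff D g i w else 0)"
    using johnson_coeff_mu[OF i, of w] johnson_coeff_outside[OF i, of w]
    by (cases "set w \<subseteq> {1..rk D}"; cases "length w = m + 1") (simp_all add: words_def)
  also have "(if w \<in> words (rk D) (m + 1) then mu_coeff D g i w else 0) =
      (\<Sum>J \<in> words (rk D) (m + 1). if J = w then mu_coeff D g i w else 0)"
    by (simp add: finite_words)
  also have "\<dots> = nc_coeff (\<Sum>J \<in> words (rk D) (m + 1). nc_smult (mu_coeff D g i J) (nc_mono J)) w"
    unfolding nc_coeff_sum by (rule sum.cong) (auto simp: nc_coeff_mono)
  finally show "nc_coeff (johnson_hom D m g (nc_X i)) w =
      nc_coeff (- (\<Sum>J \<in> words (rk D) (m + 1). nc_smult (mu_coeff D g i J) (nc_mono J))) w"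
    by simp
qed

end

end

theorem theorem3p3p7:
  fixes D :: "('a, 'l :: prime_card) ihara_data"
    and m i :: nat
    and g :: "complex \<Rightarrow> complex"
  assumes "ihara_setting D"
    and "m \<ge> 1"
    and "g \<in> Gal_filtration D m"
    and "1 \<le> i" and "i \<le> rk D"
  shows "johnson_hom D m g (nc_X i) =
           - (\<Sum>J \<in> words (rk D) (m + 1). nc_smult (mu_coeff D g i J) (nc_mono J))"
proof -
  interpret ihara D by (rule ihara.intro[OF assms(1)])
  show ?thesis
    using assms by (intro johnson_hom_X) auto
qed

end
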